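(* Suppose there exist points $a\in(0,1)$ and $b\in(0,1)$ such that (i) $f_1$ is concave on $[0,a]$ and convex on $[a,1]$; (ii) $f_2$ is convex on $[0,b]$ and concave on $[b,1]$; (iii) if $b\le a$, then $f_i<g_i$ on $[b,a]$ for $i=1,2$. Then there exists a pair $(\ell_*,r_* )\in[0,a]\times[b,1]$ such that $(D_{[0,\ell_*]},D_{[r_*,1]})$ is a solution to the Dynkin problem (DP), i.e. for every $x\in E$, $$M_1^x(D_{[0,\ell_*]},D_{[r_*,1]})=\sup_{\tau_1\in\mathcal T}M_1^x(\tau_1,D_{[r_*,1]}),\qquad M_2^x(D_{[0,\ell_*]},D_{[r_*,1]})=\sup_{\tau_2\in\mathcal T}M_2^x(D_{[0,\ell_*]},\tau_2).$$
   Context: Process. Let $W=(W_t)_{t\ge0}$ be a one-dimensional standard Brownian motion on a filtered probability space with universally completed filtration $\mathbb F=(\mathcal F_t)_{t\ge0}$. Let $E=(0,1)$, $\zeta=\inf\{t\ge0: W_t\notin E\}$, and let $X_t=W_t$ for $0\le t<\zeta$ and $X_t=\Delta$ for $t\ge\zeta$ (including $t=\infty$), where $\Delta$ is a cemetery state; $E_\Delta=E\cup\{\Delta\}$. $\mathbb P^x,\mathbb E^x$ denote probability and expectation when the process starts at $x$. Every function $\phi$ is extended by $\phi(\Delta)=0$. $\mathcal T$ is the set of $\mathbb F$-stopping times with values in $[0,\infty]$. For a measurable set $A$, $D_A=\inf\{t\ge0: X_t\in A\}$ with $\inf\emptyset=\zeta$. Rewards. For $i=1,2$, $f_i,g_i,h_i$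 are bounded continuous real functions on $[0,1]$ with $f_i\le h_i\le g_i$, vanishing at $0$ and $1$ (and at $\Delta$). Game. Writing $-i$ for the player other than $i$, for $\tau_1,\tau_2\in\mathcal T$, $$M_i^x(\tau_1,\tau_2)=\mathbb E^x\big[f_i(X_{\tau_i})1_{\{\tau_i<\tau_{-i}\}}+g_i(X_{\tau_{-i}})1_{\{\tau_{-i}<\tau_i\}}+h_i(X_{\tau_i})1_{\{\tau_i=\tau_{-i}\}}\big].$$ *)

theory Defs
  imports "HOL-Probability.Probability"
begin

section \<open>One-dimensional Brownian motion on a filtered space\<close>

text \<open>
  \<open>P x\<close> is the law under which the motion starts at \<open>x\<close>; \<open>F\<close> is the filtration before completion
  and may be larger than the natural filtration of \<open>W\<close>.  The time index of \<open>F\<close> is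
  \<^typ>\<open>ennreal\<close> so that random times with values in \<open>[0,\<infinity>]\<close> are stopping times in the sense of
  \<^const>\<open>stopping_time\<close>; the index \<open>\<infinity>\<close> puts no condition on a random time.
  The process \<open>W t\<close> is meaningful for real \<open>t \<ge> 0\<close> only.
\<close>

locale brownian_family = filtration "space M" F
  for M :: "'w measure" and F :: "ennreal \<Rightarrow> 'w measure" +
  fixes P :: "real \<Rightarrow> 'w measure" and W :: "real \<Rightarrow> 'w \<Rightarrow> real"
  assumes sub_algebra: "\<And>t. sets (F t) \<subseteq> sets M"
    and kernel: "P \<in> borel \<rightarrow>\<^sub>M prob_algebra M"
    and adapted: "\<And>t. 0 \<le> t \<Longrightarrow> W t \<in> borel_measurable (F (ennreal t))"
    and continuous_paths: "\<And>\<omega>. \<omega> \<in> space M \<Longrightarrow> continuous_on {0..} (\<lambda>t. W t \<omega>)"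
    and start: "\<And>x. AE \<omega> in P x. W 0 \<omega> = x"
    and gaussian_increments: "\<And>x s t. 0 \<le> s \<Longrightarrow> s < t \<Longrightarrow>
      distributed (P x) lborel (\<lambda>\<omega>. W t \<omega> - W s \<omega>) (normal_density 0 (sqrt (t - s)))"
    and independent_increments: "\<And>x s t. 0 \<le> s \<Longrightarrow> s < t \<Longrightarrow>
      prob_space.indep_set (P x) (sets (F (ennreal s)))
        (sets (vimage_algebra (space M) (\<lambda>\<omega>. W t \<omega> - W s \<omega>) borel))"

text \<open>
  The universal completion adjoins to \<open>F t\<close> all null sets of \<open>P\<^sup>\<mu> = \<integral> P x \<mu>(dx)\<close>, and then
  intersects over all initial laws \<open>\<mu>\<close> on the line.
\<close>

definition augmentation ::
  "'w measure \<Rightarrow> (ennreal \<Rightarrow> 'w measure) \<Rightarrow> 'w measure \<Rightarrow> ennreal \<Rightarrow> 'w measure" where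
  "augmentation M F Q t =
     sigma (space M) (sets (F t) \<union> {N. \<exists>N'\<in>null_sets Q. N \<subseteq> N'})"

definition universal_completion ::
  "'w measure \<Rightarrow> (ennreal \<Rightarrow> 'w measure) \<Rightarrow> (real \<Rightarrow> 'w measure) \<Rightarrow> ennreal \<Rightarrow> 'w measure" where
  "universal_completion M F P t =
     sigma (space M) (\<Inter>\<mu>\<in>space (prob_algebra borel). sets (augmentation M F (\<mu> \<bind> P) t))"

definition stopping_times ::
  "'w measure \<Rightarrow> (ennreal \<Rightarrow> 'w measure) \<Rightarrow> (real \<Rightarrow> 'w measure) \<Rightarrow> ('w \<Rightarrow> ennreal) set" where
  "stopping_times M F P = {\<tau>. stopping_time (universal_completion M F P) \<tau>}"


section \<open>The process killed on leaving the unit interval\<close>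

definition lifetime :: "(real \<Rightarrow> 'w \<Rightarrow> real) \<Rightarrow> 'w \<Rightarrow> ennreal" where
  "lifetime W \<omega> = Inf {ennreal t |t. 0 \<le> t \<and> W t \<omega> \<notin> {0<..<1}}"

text \<open>The cemetery state is \<^const>\<open>None\<close>; at time \<open>\<infinity>\<close> the process is always there.\<close>

definition killed :: "(real \<Rightarrow> 'w \<Rightarrow> real) \<Rightarrow> ennreal \<Rightarrow> 'w \<Rightarrow> real option" where
  "killed W t \<omega> = (if t < lifetime W \<omega> then Some (W (enn2real t) \<omega>) else None)"

definition ext :: "(real \<Rightarrow> real) \<Rightarrow> real option \<Rightarrow> real" where
  "ext \<phi> = case_option 0 \<phi>"

definition entry_time :: "(real \<Rightarrow> 'w \<Rightarrow> real) \<Rightarrow> real set \<Rightarrow> 'w \<Rightarrow> ennreal" where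
  "entry_time W A \<omega> =
     (if \<exists>t. killed W t \<omega> \<in> Some ` A then Inf {t. killed W t \<omega> \<in> Some ` A} else lifetime W \<omega>)"


section \<open>The Dynkin game\<close>

text \<open>
  Payoff, for the start at \<open>x\<close>, to the player with rewards \<open>f, g, h\<close> who stops at \<open>\<tau>\<close> while the
  opponent stops at \<open>\<sigma>\<close>.  The integral is over the completion of \<open>P x\<close> because stopping times of
  the completed filtration need not be measurable with respect to \<open>P x\<close> itself.
\<close>

definition payoff :: "(real \<Rightarrow> 'w measure) \<Rightarrow> (real \<Rightarrow> 'w \<Rightarrow> real) \<Rightarrow>
    (real \<Rightarrow> real) \<Rightarrow> (real \<Rightarrow> real) \<Rightarrow> (real \<Rightarrow> real) \<Rightarrow> real \<Rightarrow>
    ('w \<Rightarrow> ennreal) \<Rightarrow> ('w \<Rightarrow> ennreal) \<Rightarrow> real" where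
  "payoff P W f g h x \<tau> \<sigma> =
     (LINT \<omega>|completion (P x).
         ext f (killed W (\<tau> \<omega>) \<omega>) * indicator {\<omega>. \<tau> \<omega> < \<sigma> \<omega>} \<omega>
       + ext g (killed W (\<sigma> \<omega>) \<omega>) * indicator {\<omega>. \<sigma> \<omega> < \<tau> \<omega>} \<omega>
       + ext h (killed W (\<tau> \<omega>) \<omega>) * indicator {\<omega>. \<tau> \<omega> = \<sigma> \<omega>} \<omega>)"

text \<open>
  Rewards are indexed by the players \<open>1, 2\<close>.  For bounded rewards the payoffs are bounded, so the
  real suprema below are genuine ones.
\<close>

definition dynkin_solution :: "'w measure \<Rightarrow> (ennreal \<Rightarrow> 'w measure) \<Rightarrow> (real \<Rightarrow> 'w measure) \<Rightarrow>
    (real \<Rightarrow> 'w \<Rightarrow> real) \<Rightarrow>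
    (nat \<Rightarrow> real \<Rightarrow> real) \<Rightarrow> (nat \<Rightarrow> real \<Rightarrow> real) \<Rightarrow> (nat \<Rightarrow> real \<Rightarrow> real) \<Rightarrow>
    ('w \<Rightarrow> ennreal) \<Rightarrow> ('w \<Rightarrow> ennreal) \<Rightarrow> bool" where
  "dynkin_solution M F P W f g h \<tau>\<^sub>1 \<tau>\<^sub>2 \<longleftrightarrow>
     \<tau>\<^sub>1 \<in> stopping_times M F P \<and> \<tau>\<^sub>2 \<in> stopping_times M F P \<and>
     (\<forall>x\<in>{0<..<1}.
        payoff P W (f 1) (g 1) (h 1) x \<tau>\<^sub>1 \<tau>\<^sub>2
          = (SUP \<tau>\<in>stopping_times M F P. payoff P W (f 1) (g 1) (h 1) x \<tau> \<tau>\<^sub>2) \<and>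
        payoff P W (f 2) (g 2) (h 2) x \<tau>\<^sub>2 \<tau>\<^sub>1
          = (SUP \<tau>\<in>stopping_times M F P. payoff P W (f 2) (g 2) (h 2) x \<tau> \<tau>\<^sub>1))"

definition reward :: "(real \<Rightarrow> real) \<Rightarrow> bool" where
  "reward \<phi> \<longleftrightarrow> continuous_on {0..1} \<phi> \<and> bounded (\<phi> ` {0..1}) \<and> \<phi> 0 = 0 \<and> \<phi> 1 = 0"

end

theory Submission
  imports Defs
begin

text \<open>
  Given that player 2 stops on \<open>[r, 1]\<close>, player 1 faces on \<open>[0, r]\<close> a stopping problem with reward
  \<open>f\<^sub>1\<close> inside and value \<open>g\<^sub>1 r\<close> at \<open>r\<close>.  Its value is the least concave majorant, and by the shape of \<open>f\<^sub>1\<close>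
  this is \<open>f\<^sub>1\<close> up to the point \<open>l \<le> a\<close> where the tangent from \<open>(r, g\<^sub>1 r)\<close> touches, and that tangent from
  there on.  Player 2 is the mirror image.  A pair of mutual tangent points is a fixed point of a continuous
  map of \<open>[0, a]\<close> once the rewards are made strictly concave, and it survives the limit; condition (iii)
  forces \<open>l < r\<close>.

  For the verification, an affine function \<open>A\<close> above the rewards bounds the payoff at \<open>x\<close> by
  \<open>E (A W\<^sub>\<rho>) = A x\<close>, where \<open>\<rho>\<close> is the time at which the game ends.  The only fact needed about
  Brownian motion is therefore \<open>E W\<^sub>\<rho> = x\<close> for stopping times before the lifetime.
\<close>

section \<open>Mutual tangent points\<close>

text \<open>Three obstacles shape the argument. Where a reward has a linear piece, the points at
  which a tangent touches can fill a whole interval, so the reply is a set and a fixed point theorem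
  for functions does not apply. Subtracting \<open>\<epsilon> * y\<^sup>2\<close> from the rewards
  \<open>f\<close> makes it a single point. As \<open>\<epsilon>\<close> tends to 0 the two
  thresholds could collide: at \<open>l = r\<close> the closed condition reads
  \<open>0 \<le> (f r - c) * (r - y)\<close>, which is void as soon as \<open>f r = c\<close>. This
  is why the strict inequality \<open>f < g\<close> on \<open>[b, a]\<close> enters, once for the
  perturbed problem and once more for the limit. Finally, stopping times refer to the universally
  completed filtration, whereas independence of increments is given for the original one. Optional
  stopping therefore goes through a time grid: at each of countably many grid times, the event that
  the stopping time has not come yet is exchanged for an event of the original filtration, at the
  cost of a null set.\<close>

text \<open>
  The line through \<open>(l, f l)\<close> and \<open>(r, c)\<close> lies above \<open>f\<close> on \<open>[0, a]\<close>.  Multiplied by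
  \<open>r - l\<close>, this is a closed condition in \<open>(l, r, c)\<close> even at \<open>l = r\<close>.
\<close>

definition best_reply :: "(real \<Rightarrow> real) \<Rightarrow> real \<Rightarrow> real \<Rightarrow> real \<Rightarrow> real \<Rightarrow> bool" where
  "best_reply f a r c l \<longleftrightarrow> (\<forall>y\<in>{0..a}. f y * (r - l) \<le> f l * (r - y) + c * (y - l))"

text \<open>Two test points suffice. Were \<open>r \<le> l\<close>, then \<open>r\<close> would lie
  in \<open>[0, a]\<close>, and \<open>y = r\<close> would force \<open>l = r\<close> because
  \<open>f r < c\<close>; then \<open>y = 0\<close> gives \<open>(c - f r) * r \<le> 0\<close>,
  which is absurd.\<close>

lemma best_reply_less:
  assumes "best_reply f a r c l" "l \<in> {0..a}" "0 < r" "r \<le> a \<Longrightarrow> f r < c"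
  shows "l < r"
proof (rule ccontr)
  assume "\<not> l < r"
  then have lr: "r \<le> l" and ra: "r \<le> a" using assms(2) by auto
  then have fr: "f r < c" using assms(4) by simp
  have "f r * (r - l) \<le> c * (r - l)"
    using bspec[OF assms(1)[unfolded best_reply_def], of r] assms(3) ra by simp
  then have "(c - f r) * (l - r) \<le> 0" by (simp add: algebra_simps)
  with fr lr have "l = r" by (smt (verit) mult_pos_pos)
  moreover have "f 0 * (r - l) \<le> f l * (r - 0) + c * (0 - l)"
    using bspec[OF assms(1)[unfolded best_reply_def], of 0] assms(2) by simp
  ultimately have "(c - f r) * r \<le> 0" by (simp add: algebra_simps)
  with fr assms(3) show False by (smt (verit) mult_pos_pos)
qed

text \<open>Concavity with the denominator \<open>v - u\<close> cleared, to match the form of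
  \<open>best_reply\<close>.\<close>

lemma concave_on_three_points:
  fixes f :: "real \<Rightarrow> real"
  assumes "concave_on S f" "u \<in> S" "v \<in> S" "u < w" "w < v"
  shows "(v - w) * f u + (w - u) * f v \<le> f w * (v - u)"
proof -
  define t where "t = (w - u) / (v - u)"
  have t: "0 \<le> t" "t \<le> 1" "t * (v - u) = w - u" using assms by (auto simp: t_def)
  then have w: "(1 - t) * u + t * v = w" by (simp add: algebra_simps)
  have "(1 - t) * f u + t * f v \<le> f w"
    using concave_onD[OF assms(1) t(1,2) assms(2,3)] w by simp
  then have "((1 - t) * f u + t * f v) * (v - u) \<le> f w * (v - u)"
    using assms(4,5) by (intro mult_right_mono) auto
  moreover have "((1 - t) * f u + t * f v) * (v - u)
      = (v - u - t * (v - u)) * f u + (t * (v - u)) * f v"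
    by (simp add: algebra_simps)
  ultimately show ?thesis using t(3) by simp
qed

text \<open>The touching point minimises the slope \<open>(c - f y) / (r - y)\<close> over
  \<open>y < r\<close>: the line through \<open>(r, c)\<close> with the least of these slopes lies
  above \<open>f\<close> to the left of \<open>r\<close>. To the right of \<open>r\<close> it does
  so because \<open>f r < c\<close> and \<open>f\<close> is concave.\<close>

lemma best_reply_ex:
  assumes cont: "continuous_on {0..a} f" and conc: "concave_on {0..a} f"
    and "0 < a" "0 < r" and fr: "r \<le> a \<Longrightarrow> f r < c"
  shows "\<exists>l\<in>{0..a}. best_reply f a r c l"
proof -
  \<comment> \<open>For \<open>r \<le> a\<close> the slope blows up at \<open>y = r\<close>, so the
    minimum is sought on a compact \<open>[0, d]\<close> with \<open>d < r\<close>. Between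
    \<open>d\<close> and \<open>r\<close> the slope exceeds its value at 0, and 0 is a competitor in
    the minimum.\<close>
  have "\<exists>d\<in>{0..a}. d < r \<and> (\<forall>y\<in>{0..a}. d < y \<longrightarrow> y < r \<longrightarrow> (c - f 0) * (r - y) < (c - f y) * r)"
  proof (cases "r \<le> a")
    case False
    with \<open>0 < a\<close> show ?thesis by (intro bexI[of _ a]) auto
  next
    case True
    define k where "k y = (c - f y) * r - (c - f 0) * (r - y)" for y
    have "continuous_on {0..a} k" unfolding k_def by (intro continuous_intros cont)
    moreover have "r \<in> {0..a}" "0 < k r" using True assms(4) fr by (auto simp: k_def)
    ultimately obtain \<delta> where \<delta>: "0 < \<delta>" "\<And>y. y \<in> {0..a} \<Longrightarrow> dist y r < \<delta> \<Longrightarrow> dist (k y) (k r) < k r"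
      unfolding continuous_on_iff by blast
    have "0 < k y" if "y \<in> {0..a}" "max 0 (r - \<delta> / 2) < y" "y < r" for y
      using \<delta>(2)[OF that(1)] that \<delta>(1) by (auto simp: dist_real_def abs_if split: if_splits)
    with \<delta>(1) True assms(4) show ?thesis
      by (intro bexI[of _ "max 0 (r - \<delta> / 2)"]) (auto simp: k_def)
  qed
  then obtain d where d: "0 \<le> d" "d \<le> a" "d < r"
    and d2: "\<And>y. y \<in> {0..a} \<Longrightarrow> d < y \<Longrightarrow> y < r \<Longrightarrow> (c - f 0) * (r - y) < (c - f y) * r"
    by auto
  have "continuous_on {0..d} (\<lambda>y. (c - f y) / (r - y))"
    using d by (intro continuous_intros continuous_on_subset[OF cont]) auto
  moreover have "compact {0..d}" "{0..d} \<noteq> {}" using d by auto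
  ultimately obtain l where l: "l \<in> {0..d}"
    and l2: "\<And>y. y \<in> {0..d} \<Longrightarrow> (c - f l) / (r - l) \<le> (c - f y) / (r - y)"
    using continuous_attains_inf[of "{0..d}" "\<lambda>y. (c - f y) / (r - y)"] by blast
  have lr: "l < r" using l d by auto
  have A: "(c - f l) * (r - y) \<le> (c - f y) * (r - l)" if y: "y \<in> {0..a}" "y < r" for y
  proof (cases "y \<le> d")
    case True
    then show ?thesis using l2[of y] y lr by (simp add: divide_simps mult.commute split: if_splits)
  next
    case False
    then have "(c - f 0) / r \<le> (c - f y) / (r - y)"
      using d2[of y] y assms(4) by (simp add: divide_simps mult.commute less_imp_le split: if_splits)
    moreover have "(c - f l) / (r - l) \<le> (c - f 0) / r" using l2[of 0] d by simp
    ultimately have "(c - f l) / (r - l) \<le> (c - f y) / (r - y)" by simp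
    then show ?thesis using y lr by (simp add: divide_simps mult.commute split: if_splits)
  qed
  have "f y * (r - l) \<le> f l * (r - y) + c * (y - l)" if y: "y \<in> {0..a}" for y
  proof (cases y r rule: linorder_cases)
    case less
    then show ?thesis using A[OF y less] by (simp add: algebra_simps)
  next
    case equal
    then have "f r * (r - l) \<le> c * (r - l)" using y fr lr by (intro mult_right_mono) auto
    then show ?thesis using equal by simp
  next
    case greater
    have "(y - r) * f l + (r - l) * f y \<le> f r * (y - l)"
      using concave_on_three_points[OF conc _ y lr greater] l d by auto
    also have "\<dots> \<le> c * (y - l)" using greater y fr lr by (intro mult_right_mono) auto
    finally show ?thesis by (simp add: algebra_simps)
  qed
  then show ?thesis using l d unfolding best_reply_def by (intro bexI[of _ l]) auto
qed

text \<open>Each touching point lies below the line of the other, so both lie on one line through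
  \<open>(r, c)\<close>. This line majorises \<open>f\<close>, yet strict midpoint concavity puts
  \<open>f\<close> above it halfway between them.\<close>

lemma best_reply_unique:
  assumes strict: "\<And>u v. u \<in> {0..a} \<Longrightarrow> v \<in> {0..a} \<Longrightarrow> u \<noteq> v \<Longrightarrow> (f u + f v) / 2 < f ((u + v) / 2)"
    and l: "best_reply f a r c l" "l \<in> {0..a}" "l < r"
    and k: "best_reply f a r c k" "k \<in> {0..a}" "k < r"
  shows "l = k"
proof (rule ccontr)
  assume "l \<noteq> k"
  have m: "(l + k) / 2 \<in> {0..a}" using l k by auto
  have 1: "f k * (r - l) \<le> f l * (r - k) + c * (k - l)"
    using l k unfolding best_reply_def by blast
  have 2: "f l * (r - k) \<le> f k * (r - l) + c * (l - k)"
    using l k unfolding best_reply_def by blast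
  have 3: "f ((l + k) / 2) * (r - l) \<le> f l * (r - (l + k) / 2) + c * ((l + k) / 2 - l)"
    using l m unfolding best_reply_def by blast
  have "f l * (r - (l + k) / 2) + c * ((l + k) / 2 - l)
      = (f l * (r - l) + (f l * (r - k) + c * (k - l))) / 2"
    by (simp add: field_simps)
  also have "f l * (r - k) + c * (k - l) = f k * (r - l)" using 1 2 by (simp add: algebra_simps)
  finally have "f ((l + k) / 2) * (r - l) \<le> (f l + f k) / 2 * (r - l)"
    using 3 by (simp add: field_simps)
  moreover have "(f l + f k) / 2 * (r - l) < f ((l + k) / 2) * (r - l)"
    using strict[OF l(2) k(2) \<open>l \<noteq> k\<close>] l(3) by (intro mult_strict_right_mono) auto
  ultimately show False by simp
qed

text \<open>Serves twice: with \<open>\<epsilon>\<close> constantly 0 it closes the graph of the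
  reply, and with \<open>\<epsilon>\<close> tending to 0 it removes the perturbation.\<close>

lemma best_reply_limit:
  assumes "continuous_on {0..a} f" "\<And>n. l n \<in> {0..a}" "l0 \<in> {0..a}"
    and "l \<longlonglongrightarrow> l0" "r \<longlonglongrightarrow> r0" "c \<longlonglongrightarrow> c0" "\<epsilon> \<longlonglongrightarrow> 0"
    and "\<And>n. best_reply (\<lambda>y. f y - \<epsilon> n * y\<^sup>2) a (r n) (c n) (l n)"
  shows "best_reply f a r0 c0 l0"
  unfolding best_reply_def
proof
  fix y assume y: "y \<in> {0..a}"
  have f: "(\<lambda>n. f (l n)) \<longlonglongrightarrow> f l0"
    by (rule continuous_on_tendsto_compose[OF assms(1,4)]) (use assms in auto)
  have "(\<lambda>n. (f y - \<epsilon> n * y\<^sup>2) * (r n - l n)) \<longlonglongrightarrow> (f y - 0 * y\<^sup>2) * (r0 - l0)"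
    by (intro tendsto_intros assms)
  moreover have "(\<lambda>n. (f (l n) - \<epsilon> n * (l n)\<^sup>2) * (r n - y) + c n * (y - l n))
      \<longlonglongrightarrow> (f l0 - 0 * l0\<^sup>2) * (r0 - y) + c0 * (y - l0)"
    by (intro tendsto_intros assms f)
  ultimately have "(f y - 0 * y\<^sup>2) * (r0 - l0) \<le> (f l0 - 0 * l0\<^sup>2) * (r0 - y) + c0 * (y - l0)"
    by (rule LIMSEQ_le) (use assms(8) y in \<open>auto simp: best_reply_def\<close>)
  then show "f y * (r0 - l0) \<le> f l0 * (r0 - y) + c0 * (y - l0)" by simp
qed

text \<open>The perturbation makes the reply unique, hence continuous in \<open>r\<close>.\<close>

lemma best_reply_function:
  assumes cont: "continuous_on {0..a} f" and conc: "concave_on {0..a} f"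
    and "0 < a" "0 < b" and contg: "continuous_on {b..1} g"
    and less: "\<And>r. r \<in> {b..1} \<Longrightarrow> r \<le> a \<Longrightarrow> f r < g r" and "0 < \<epsilon>"
  obtains L where "continuous_on {b..1} L" "L \<in> {b..1} \<rightarrow> {0..a}"
    "\<And>r. r \<in> {b..1} \<Longrightarrow> best_reply (\<lambda>y. f y - \<epsilon> * y\<^sup>2) a r (g r) (L r)"
proof -
  define F where "F y = f y - \<epsilon> * y\<^sup>2" for y
  have contF: "continuous_on {0..a} F" unfolding F_def by (intro continuous_intros cont)
  have "convex_on {0..a} (\<lambda>y::real. y\<^sup>2)"
    by (rule convex_on_subset[OF convex_power2]) simp_all
  then have "convex_on {0..a} (\<lambda>y. - f y + \<epsilon> * y\<^sup>2)"
    using conc \<open>0 < \<epsilon>\<close> unfolding concave_on_def by (intro convex_on_add convex_on_cmul) auto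
  then have concF: "concave_on {0..a} F" by (simp add: concave_on_def F_def)
  have strict: "(F u + F v) / 2 < F ((u + v) / 2)" if "u \<in> {0..a}" "v \<in> {0..a}" "u \<noteq> v" for u v
  proof -
    have "(f u + f v) / 2 \<le> f ((u + v) / 2)"
      using concave_onD[OF conc, of "1/2" u v] that by (simp add: add_divide_distrib)
    \<comment> \<open>The square at the midpoint falls short of the average of the squares by
      \<open>(u - v)\<^sup>2 / 4\<close>, which turns weak concavity of \<open>f\<close> into strict
      concavity of \<open>F\<close>.\<close>
    moreover have "0 < \<epsilon> * (u - v)\<^sup>2" using that \<open>0 < \<epsilon>\<close> by simp
    then have "\<epsilon> * ((u + v) / 2)\<^sup>2 < (\<epsilon> * u\<^sup>2 + \<epsilon> * v\<^sup>2) / 2"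
      by (simp add: power2_eq_square field_simps)
    ultimately show ?thesis unfolding F_def by (simp add: field_simps)
  qed
  have lessF: "F r < g r" if "r \<in> {b..1}" "r \<le> a" for r
  proof -
    have "0 \<le> \<epsilon> * r\<^sup>2" using \<open>0 < \<epsilon>\<close> by simp
    with less[OF that] show ?thesis by (simp add: F_def)
  qed
  have "\<forall>r\<in>{b..1}. \<exists>l\<in>{0..a}. best_reply F a r (g r) l"
    using best_reply_ex[OF contF concF \<open>0 < a\<close>] lessF \<open>0 < b\<close> by auto
  then obtain L where L: "\<And>r. r \<in> {b..1} \<Longrightarrow> L r \<in> {0..a}"
    "\<And>r. r \<in> {b..1} \<Longrightarrow> best_reply F a r (g r) (L r)"
    by metis
  have uniq: "l = L r" if "r \<in> {b..1}" "l \<in> {0..a}" "best_reply F a r (g r) l" for l r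
  proof -
    have lt: "k < r" if "k \<in> {0..a}" "best_reply F a r (g r) k" for k
      by (rule best_reply_less[OF that(2,1)]) (use \<open>r \<in> {b..1}\<close> lessF \<open>0 < b\<close> in auto)
    show ?thesis
      by (rule best_reply_unique[OF strict that(3,2) _ L(2)[OF that(1)] L(1)[OF that(1)]])
        (use lt that L in auto)
  qed
  \<comment> \<open>A function into the compact \<open>[0, a]\<close> with closed graph is
    continuous. A limit of replies is a reply, and by uniqueness it is the one chosen by
    \<open>L\<close>.\<close>
  have "closed ((\<lambda>r. (r, L r)) ` {b..1})"
    unfolding closed_sequential_limits
  proof safe
    fix x r0 l0 assume x: "\<forall>n. x n \<in> (\<lambda>r. (r, L r)) ` {b..1}" and lim: "x \<longlonglongrightarrow> (r0, l0)"
    define r where "r n = fst (x n)" for n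
    have r: "r n \<in> {b..1}" "snd (x n) = L (r n)" for n using x[rule_format, of n] by (auto simp: r_def)
    have lim1: "r \<longlonglongrightarrow> r0" using tendsto_fst[OF lim] by (simp add: r_def[abs_def])
    have lim2: "(\<lambda>n. L (r n)) \<longlonglongrightarrow> l0" using tendsto_snd[OF lim] r by simp
    have r0: "r0 \<in> {b..1}" by (rule closed_sequentially[OF _ _ lim1]) (use r in auto)
    have l0: "l0 \<in> {0..a}" by (rule closed_sequentially[OF _ _ lim2]) (use r L in auto)
    have lim3: "(\<lambda>n. g (r n)) \<longlonglongrightarrow> g r0"
      by (rule continuous_on_tendsto_compose[OF contg lim1 r0]) (use r in auto)
    have "best_reply F a r0 (g r0) l0"
      by (rule best_reply_limit[OF contF _ l0 lim2 lim1 lim3, where \<epsilon>="\<lambda>_. 0"]) (use r L in auto)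
    then have "l0 = L r0" using uniq r0 l0 by blast
    with r0 show "(r0, l0) \<in> (\<lambda>r. (r, L r)) ` {b..1}" by auto
  qed
  then have "continuous_on {b..1} L"
    by (intro continuous_from_closed_graph[of "{0..a}"]) (use L in auto)
  then show thesis using that L unfolding F_def by blast
qed

section \<open>Reflection of player 2 and the fixed point\<close>

lemma concave_on_reflect:
  fixes f :: "real \<Rightarrow> real"
  assumes "concave_on {b..1} f"
  shows "concave_on {0..1 - b} (\<lambda>y. f (1 - y))"
  unfolding concave_on_iff
proof (intro conjI ballI allI impI)
  show "convex {0..1 - b}" by simp
  fix x y u v :: real
  assume xy: "x \<in> {0..1 - b}" "y \<in> {0..1 - b}" and u: "0 \<le> u" "0 \<le> v" "u + v = 1"
  then have "f (u *\<^sub>R (1 - x) + v *\<^sub>R (1 - y)) \<ge> u * f (1 - x) + v * f (1 - y)"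
    using assms unfolding concave_on_iff by auto
  moreover have "u *\<^sub>R (1 - x) + v *\<^sub>R (1 - y) = 1 - (u *\<^sub>R x + v *\<^sub>R y)"
    using u(3) by (simp add: algebra_simps)
  ultimately show "f (1 - (u *\<^sub>R x + v *\<^sub>R y)) \<ge> u * f (1 - x) + v * f (1 - y)" by simp
qed

lemma convex_on_reflect:
  fixes f :: "real \<Rightarrow> real"
  assumes "convex_on {0..b} f"
  shows "convex_on {1 - b..1} (\<lambda>y. f (1 - y))"
proof (intro convex_onI)
  show "convex {1 - b..1}" by simp
  fix t x y :: real assume "0 < t" "t < 1" and "x \<in> {1 - b..1}" "y \<in> {1 - b..1}"
  then have "f ((1 - t) *\<^sub>R (1 - x) + t *\<^sub>R (1 - y)) \<le> (1 - t) * f (1 - x) + t * f (1 - y)"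
    using convex_onD[OF assms, of t "1 - x" "1 - y"] by simp
  moreover have "(1 - t) *\<^sub>R (1 - x) + t *\<^sub>R (1 - y) = 1 - ((1 - t) *\<^sub>R x + t *\<^sub>R y)"
    by (simp add: algebra_simps)
  ultimately show "f (1 - ((1 - t) *\<^sub>R x + t *\<^sub>R y)) \<le> (1 - t) * f (1 - x) + t * f (1 - y)" by simp
qed

lemma mutual_best_reply:
  assumes ab: "a \<in> {0<..<1}" "b \<in> {0<..<1}"
    and cont: "continuous_on {0..1} f\<^sub>1" "continuous_on {0..1} f\<^sub>2"
      "continuous_on {0..1} g\<^sub>1" "continuous_on {0..1} g\<^sub>2"
    and conc: "concave_on {0..a} f\<^sub>1" "concave_on {b..1} f\<^sub>2"
    and less: "\<And>x. x \<in> {b..a} \<Longrightarrow> f\<^sub>1 x < g\<^sub>1 x \<and> f\<^sub>2 x < g\<^sub>2 x"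
  obtains l r where "l \<in> {0..a}" "r \<in> {b..1}" "best_reply f\<^sub>1 a r (g\<^sub>1 r) l"
    "best_reply (\<lambda>y. f\<^sub>2 (1 - y)) (1 - b) (1 - l) (g\<^sub>2 l) (1 - r)"
proof -
  have c1: "continuous_on {0..a} f\<^sub>1" "continuous_on {b..1} g\<^sub>1"
    using ab by (auto intro: continuous_on_subset[OF cont(1)] continuous_on_subset[OF cont(3)])
  have c2: "continuous_on {0..1 - b} (\<lambda>y. f\<^sub>2 (1 - y))" "continuous_on {1 - a..1} (\<lambda>y. g\<^sub>2 (1 - y))"
    using ab by (auto intro!: continuous_on_compose2[OF cont(2)] continuous_on_compose2[OF cont(4)]
        continuous_intros)
  have "\<exists>l\<in>{0..a}. \<exists>r\<in>{b..1}. best_reply (\<lambda>y. f\<^sub>1 y - \<epsilon> * y\<^sup>2) a r (g\<^sub>1 r) l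
    \<and> best_reply (\<lambda>y. f\<^sub>2 (1 - y) - \<epsilon> * y\<^sup>2) (1 - b) (1 - l) (g\<^sub>2 l) (1 - r)" if eps: "0 < \<epsilon>" for \<epsilon>
  proof -
    obtain L where L: "continuous_on {b..1} L" "L \<in> {b..1} \<rightarrow> {0..a}"
      "\<And>r. r \<in> {b..1} \<Longrightarrow> best_reply (\<lambda>y. f\<^sub>1 y - \<epsilon> * y\<^sup>2) a r (g\<^sub>1 r) (L r)"
      by (rule best_reply_function[OF c1(1) conc(1) _ _ c1(2) _ eps]) (use ab less in auto)
    \<comment> \<open>Player 2 is treated in the coordinate \<open>1 - y\<close>: a threshold
      \<open>l\<close> of player 1 becomes \<open>1 - l\<close> in \<open>[1 - a, 1]\<close>, and
      the concave part \<open>[b, 1]\<close> becomes \<open>[0, 1 - b]\<close>. Both replies thus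
      come from the same lemma.\<close>
    have less': "f\<^sub>2 (1 - r) < g\<^sub>2 (1 - r)" if "r \<in> {1 - a..1}" "r \<le> 1 - b" for r
      using less[of "1 - r"] that by auto
    obtain R where R: "continuous_on {1 - a..1} R" "R \<in> {1 - a..1} \<rightarrow> {0..1 - b}"
      "\<And>r. r \<in> {1 - a..1} \<Longrightarrow>
        best_reply (\<lambda>y. f\<^sub>2 (1 - y) - \<epsilon> * y\<^sup>2) (1 - b) r (g\<^sub>2 (1 - r)) (R r)"
      by (rule best_reply_function[OF c2(1) concave_on_reflect[OF conc(2)] _ _ c2(2) less' eps])
        (use ab in auto)
    have RI: "1 - R (1 - x) \<in> {b..1}" if "x \<in> {0..a}" for x
      using funcset_mem[OF R(2), of "1 - x"] that by auto
    \<comment> \<open>A threshold of player 1 is sent to player 2's reply, and this to player 1's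
      reply. A fixed point of the round trip is a pair of mutual replies.\<close>
    have "continuous_on {0..a} (\<lambda>x. L (1 - R (1 - x)))"
      by (intro continuous_on_compose2[OF L(1)] continuous_on_compose2[OF R(1)] continuous_intros)
        (use RI in force)+
    moreover have "(\<lambda>x. L (1 - R (1 - x))) \<in> {0..a} \<rightarrow> {0..a}" using RI L(2) by blast
    ultimately obtain l where l: "l \<in> {0..a}" "L (1 - R (1 - l)) = l"
      using brouwer[of "{0..a}" "\<lambda>x. L (1 - R (1 - x))"] ab by auto
    with RI[OF l(1)] L(3)[OF RI[OF l(1)]] R(3)[of "1 - l"] show ?thesis
      by (intro bexI[of _ l] bexI[of _ "1 - R (1 - l)"]) auto
  qed
  then have "\<forall>n. \<exists>l r. l \<in> {0..a} \<and> r \<in> {b..1}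
    \<and> best_reply (\<lambda>y. f\<^sub>1 y - inverse (real (Suc n)) * y\<^sup>2) a r (g\<^sub>1 r) l
    \<and> best_reply (\<lambda>y. f\<^sub>2 (1 - y) - inverse (real (Suc n)) * y\<^sup>2) (1 - b) (1 - l) (g\<^sub>2 l) (1 - r)"
    by (simp add: Bex_def)
  then obtain u v where p: "\<And>n. u n \<in> {0..a} \<and> v n \<in> {b..1}
    \<and> best_reply (\<lambda>y. f\<^sub>1 y - inverse (real (Suc n)) * y\<^sup>2) a (v n) (g\<^sub>1 (v n)) (u n)
    \<and> best_reply (\<lambda>y. f\<^sub>2 (1 - y) - inverse (real (Suc n)) * y\<^sup>2) (1 - b) (1 - u n)
      (g\<^sub>2 (u n)) (1 - v n)"
    unfolding choice_iff by blast
  have "seq_compact ({0..a} \<times> {b..1})" unfolding compact_eq_seq_compact_metric[symmetric] by (intro compact_Times) auto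
  moreover have "\<forall>n. (u n, v n) \<in> {0..a} \<times> {b..1}" using p by auto
  ultimately obtain q s where q: "q \<in> {0..a} \<times> {b..1}" and s: "strict_mono s"
    "((\<lambda>n. (u n, v n)) \<circ> s) \<longlonglongrightarrow> q"
    by (rule seq_compactE) blast+
  define l r where "l = fst q" and "r = snd q"
  have lr: "l \<in> {0..a}" "r \<in> {b..1}" using q by (auto simp: l_def r_def)
  have lim: "(\<lambda>n. u (s n)) \<longlonglongrightarrow> l" "(\<lambda>n. v (s n)) \<longlonglongrightarrow> r"
    using tendsto_fst[OF s(2)] tendsto_snd[OF s(2)] by (auto simp: l_def r_def o_def)
  have lim0: "(\<lambda>n. inverse (real (Suc (s n)))) \<longlonglongrightarrow> 0"
    using LIMSEQ_subseq_LIMSEQ[OF LIMSEQ_inverse_real_of_nat s(1)] by (simp add: o_def)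
  have us: "u n \<in> {0..1}" "v n \<in> {0..1}" for n using p[of n] ab by auto
  have lr01: "l \<in> {0..1}" "r \<in> {0..1}" using lr ab by auto
  have limg: "(\<lambda>n. g\<^sub>1 (v (s n))) \<longlonglongrightarrow> g\<^sub>1 r"
    by (rule continuous_on_tendsto_compose[OF cont(3) lim(2) lr01(2)]) (simp only: us eventually_True)
  have limg': "(\<lambda>n. g\<^sub>2 (u (s n))) \<longlonglongrightarrow> g\<^sub>2 l"
    by (rule continuous_on_tendsto_compose[OF cont(4) lim(1) lr01(1)]) (simp only: us eventually_True)
  have "best_reply f\<^sub>1 a r (g\<^sub>1 r) l"
    by (rule best_reply_limit[OF c1(1) _ lr(1) lim(1,2) limg lim0]) (use p in blast)+
  moreover have "best_reply (\<lambda>y. f\<^sub>2 (1 - y)) (1 - b) (1 - l) (g\<^sub>2 l) (1 - r)"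
  proof (rule best_reply_limit[OF c2(1) _ _ tendsto_diff[OF tendsto_const lim(2)]
          tendsto_diff[OF tendsto_const lim(1)] limg' lim0])
    show "1 - v (s n) \<in> {0..1 - b}" for n using p[of "s n"] by auto
    show "1 - r \<in> {0..1 - b}" using lr by auto
  qed (use p in blast)
  ultimately show thesis using that lr by blast
qed

section \<open>Affine functions above the rewards\<close>

text \<open>The majorant depends on the starting point. For \<open>x < l\<close>, where it is best
  to stop at once, it is a supporting line of \<open>f\<close> at \<open>x\<close>; otherwise it is
  the line through \<open>(l, f l)\<close> and \<open>(r, c)\<close>, which agrees with the payoff
  at both ends of the continuation interval.\<close>

lemma affine_majorant:
  assumes conc: "concave_on {0..a} f" and conv: "convex_on {a..1} f" and "0 < a"
    and l: "0 \<le> l" "l \<le> a" "l < r" and "r \<le> 1" "f r \<le> c"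
    and best: "best_reply f a r c l" and x: "0 < x" "x < r"
  obtains \<alpha> \<beta> where "\<And>y. y \<in> {0..r} \<Longrightarrow> f y \<le> \<alpha> + \<beta> * y" "c \<le> \<alpha> + \<beta> * r"
    "x \<le> l \<Longrightarrow> \<alpha> + \<beta> * x = f x" "l < x \<Longrightarrow> \<alpha> + \<beta> * l = f l \<and> \<alpha> + \<beta> * r = c"
proof -
  \<comment> \<open>Domination on \<open>[0, a]\<close> and at \<open>r\<close> is enough: between
    \<open>a\<close> and \<open>r\<close> the convex \<open>f\<close> lies below the segment joining
    its end values, and this segment lies below the line.\<close>
  have extend: "f y \<le> \<alpha> + \<beta> * y"
    if A: "\<And>y. y \<in> {0..a} \<Longrightarrow> f y \<le> \<alpha> + \<beta> * y" and r: "c \<le> \<alpha> + \<beta> * r" and y: "y \<in> {0..r}" for \<alpha> \<beta> y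
  proof (cases "y \<le> a \<or> y = r")
    case True
    then show ?thesis using A y r \<open>f r \<le> c\<close> by auto
  next
    case False
    then have ay: "a < y" "y < r" using y by auto
    have "concave_on {a..1} (\<lambda>y. - f y)" using conv by (simp add: concave_on_def)
    then have "(r - y) * - f a + (y - a) * - f r \<le> - f y * (r - a)"
      by (rule concave_on_three_points) (use ay \<open>r \<le> 1\<close> in auto)
    moreover have "(r - y) * f a \<le> (r - y) * (\<alpha> + \<beta> * a)"
      using A[of a] \<open>0 < a\<close> ay by (intro mult_left_mono) auto
    moreover have "(y - a) * f r \<le> (y - a) * (\<alpha> + \<beta> * r)"
      using r \<open>f r \<le> c\<close> ay by (intro mult_left_mono) auto
    ultimately have "f y * (r - a) \<le> (\<alpha> + \<beta> * y) * (r - a)" by (simp add: algebra_simps)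
    then show ?thesis using ay by simp
  qed
  define \<beta>\<^sub>0 where "\<beta>\<^sub>0 = (c - f l) / (r - l)"
  define \<alpha>\<^sub>0 where "\<alpha>\<^sub>0 = f l - \<beta>\<^sub>0 * l"
  have \<beta>\<^sub>0: "\<beta>\<^sub>0 * (r - l) = c - f l" using l by (simp add: \<beta>\<^sub>0_def)
  have line: "\<alpha>\<^sub>0 + \<beta>\<^sub>0 * l = f l" "\<alpha>\<^sub>0 + \<beta>\<^sub>0 * r = c" using \<beta>\<^sub>0 by (auto simp: \<alpha>\<^sub>0_def algebra_simps)
  have above: "f y \<le> \<alpha>\<^sub>0 + \<beta>\<^sub>0 * y" if "y \<in> {0..a}" for y
  proof -
    have "f y * (r - l) \<le> f l * (r - y) + c * (y - l)" using best that by (auto simp: best_reply_def)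
    also have "\<dots> = f l * (r - l) + (c - f l) * (y - l)" by (simp add: algebra_simps)
    also have "\<dots> = (\<alpha>\<^sub>0 + \<beta>\<^sub>0 * y) * (r - l)"
      unfolding \<beta>\<^sub>0[symmetric] \<alpha>\<^sub>0_def by (simp add: algebra_simps)
    finally show ?thesis using l by simp
  qed
  show thesis
  proof (cases "x < l")
    case False
    then show thesis using that[of \<alpha>\<^sub>0 \<beta>\<^sub>0] extend[OF above] line by force
  next
    case True
    have "convex_on {0..a} (\<lambda>y. - f y)" using conc by (simp add: concave_on_def)
    moreover have "x \<in> interior {0..a}" using x True l by simp
    ultimately obtain m where m: "\<And>y. y \<in> {0..a} \<Longrightarrow> - f y \<ge> - f x + m * (y - x)"
      using convex_le_Inf_differential by blast
    define \<alpha> \<beta> where "\<alpha> = f x + m * x" and "\<beta> = - m"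
    have B: "f y \<le> \<alpha> + \<beta> * y" if "y \<in> {0..a}" for y
      using m[OF that] by (simp add: \<alpha>_def \<beta>_def algebra_simps)
    have eq: "\<alpha> + \<beta> * x = f x" by (simp add: \<alpha>_def \<beta>_def)
    \<comment> \<open>The supporting line is at least the tangent line at \<open>l\<close> and at
      most the tangent line at \<open>x < l\<close>. It is therefore at least as steep and still
      above it at \<open>r\<close>, where the tangent line has the value \<open>c\<close>.\<close>
    have "\<alpha>\<^sub>0 + \<beta>\<^sub>0 * l \<le> \<alpha> + \<beta> * l" using B[of l] line l by auto
    moreover have "\<alpha> + \<beta> * x \<le> \<alpha>\<^sub>0 + \<beta>\<^sub>0 * x" using above[of x] eq x True l by auto
    ultimately have "0 \<le> (\<beta> - \<beta>\<^sub>0) * (l - x)" by (simp add: algebra_simps)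
    then have "\<beta>\<^sub>0 \<le> \<beta>" using True by (simp add: zero_le_mult_iff)
    then have "0 \<le> (\<beta> - \<beta>\<^sub>0) * (r - l)" using l by simp
    with \<open>\<alpha>\<^sub>0 + \<beta>\<^sub>0 * l \<le> \<alpha> + \<beta> * l\<close> line have "c \<le> \<alpha> + \<beta> * r" by (simp add: algebra_simps)
    then show thesis using that[of \<alpha> \<beta>] extend[OF B] eq True by auto
  qed
qed

section \<open>Exit times of a continuous path\<close>

text \<open>One form for the lifetime and both strategies: the lifetime is the exit from
  \<open>(0, 1)\<close>, the entry into \<open>[0, l]\<close> is the exit from
  \<open>(l, 1)\<close>, and the entry into \<open>[r, 1]\<close> is the exit from
  \<open>(0, r)\<close>.\<close>

definition exit_time :: "real \<Rightarrow> real \<Rightarrow> (real \<Rightarrow> 'w \<Rightarrow> real) \<Rightarrow> 'w \<Rightarrow> ennreal" where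
  "exit_time p q W \<omega> = Inf {ennreal t |t. 0 \<le> t \<and> W t \<omega> \<notin> {p<..<q}}"

lemma lifetime_eq_exit_time: "lifetime W \<omega> = exit_time 0 1 W \<omega>"
  unfolding lifetime_def exit_time_def ..

lemma before_exit_time:
  assumes "0 \<le> t" "ennreal t < exit_time p q W \<omega>"
  shows "W t \<omega> \<in> {p<..<q}"
proof (rule ccontr)
  assume "W t \<omega> \<notin> {p<..<q}"
  then have "exit_time p q W \<omega> \<le> ennreal t"
    unfolding exit_time_def using assms(1) by (intro Inf_lower) blast
  with assms(2) show False by simp
qed

lemma exit_time_mono: "p \<le> p' \<Longrightarrow> q' \<le> q \<Longrightarrow> exit_time p' q' W \<omega> \<le> exit_time p q W \<omega>"
  unfolding exit_time_def by (rule Inf_superset_mono) force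

lemma exit_time_eq_0: "W 0 \<omega> \<notin> {p<..<q} \<Longrightarrow> exit_time p q W \<omega> = 0"
  using before_exit_time[of 0 p q W \<omega>] by (auto simp: zero_less_iff_neq_zero)

context
  fixes W :: "real \<Rightarrow> 'w \<Rightarrow> real" and \<omega> :: 'w
  assumes cont: "continuous_on {0..} (\<lambda>t. W t \<omega>)"
begin

lemma exit_time_attained:
  assumes "exit_time p q W \<omega> < \<top>"
  obtains s where "0 \<le> s" "exit_time p q W \<omega> = ennreal s" "W s \<omega> \<notin> {p<..<q}"
proof -
  define Z where "Z = {0..} \<inter> (\<lambda>t. W t \<omega>) -` (- {p<..<q})"
  have eq: "exit_time p q W \<omega> = Inf (ennreal ` Z)"
    unfolding exit_time_def Z_def by (rule arg_cong[where f=Inf]) auto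
  have "Z \<noteq> {}" using assms unfolding eq by auto
  moreover have "closed Z"
    unfolding Z_def by (intro continuous_closed_preimage[OF cont]) auto
  moreover have bdd: "bdd_below Z" by (auto simp: Z_def intro!: bdd_belowI[of _ 0])
  ultimately have Z: "Inf Z \<in> Z" using closed_contains_Inf by blast
  have "Inf (ennreal ` Z) = ennreal (Inf Z)"
    by (intro antisym Inf_lower Inf_greatest) (use Z bdd in \<open>auto intro!: ennreal_leI cInf_lower\<close>)
  then show thesis using Z eq by (intro that[of "Inf Z"]) (auto simp: Z_def)
qed

lemma exit_time_le_iff:
  assumes "0 \<le> t"
  shows "exit_time p q W \<omega> \<le> ennreal t \<longleftrightarrow> (\<exists>s\<in>{0..t}. W s \<omega> \<notin> {p<..<q})"
proof
  assume le: "exit_time p q W \<omega> \<le> ennreal t"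
  then have "exit_time p q W \<omega> < \<top>" using ennreal_less_top le_less_trans by blast
  then obtain s where "0 \<le> s" "exit_time p q W \<omega> = ennreal s" "W s \<omega> \<notin> {p<..<q}"
    by (rule exit_time_attained)
  with le assms show "\<exists>s\<in>{0..t}. W s \<omega> \<notin> {p<..<q}" by auto
next
  assume "\<exists>s\<in>{0..t}. W s \<omega> \<notin> {p<..<q}"
  then obtain s where s: "s \<in> {0..t}" "W s \<omega> \<notin> {p<..<q}" by auto
  then have "\<not> ennreal s < exit_time p q W \<omega>" using before_exit_time[of s p q W \<omega>] by auto
  moreover have "ennreal s \<le> ennreal t" using s by (intro ennreal_leI) auto
  ultimately show "exit_time p q W \<omega> \<le> ennreal t" by auto
qed

lemma exit_time_pos:
  assumes "W 0 \<omega> \<in> {p<..<q}"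
  shows "0 < exit_time p q W \<omega>"
proof -
  have "\<not> exit_time p q W \<omega> \<le> ennreal 0" using exit_time_le_iff[of 0 p q] assms by simp
  then show ?thesis by (simp add: zero_less_iff_neq_zero)
qed

text \<open>A path strictly beyond an end point at its exit time would have crossed this end point
  earlier, by the intermediate value theorem, and so would have left the open interval
  earlier.\<close>

lemma exit_time_boundary:
  assumes "W 0 \<omega> \<in> {p<..<q}" "0 \<le> s" "exit_time p q W \<omega> = ennreal s"
  shows "W s \<omega> \<in> {p, q}"
proof (rule ccontr)
  assume ns: "W s \<omega> \<notin> {p, q}"
  have out: "W s \<omega> \<notin> {p<..<q}"
    using exit_time_attained[of p q] assms by (metis ennreal_inj ennreal_less_top)
  have cs: "continuous_on {0..s} (\<lambda>t. W t \<omega>)" by (rule continuous_on_subset[OF cont]) auto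
  have "\<exists>t\<in>{0..s}. W t \<omega> \<in> {p, q}"
  proof (cases "W s \<omega> < p")
    case True
    then show ?thesis using IVT2'[of "\<lambda>t. W t \<omega>" s p 0, OF _ _ _ cs] assms by force
  next
    case False
    then have "q < W s \<omega>" using ns out by auto
    then show ?thesis using IVT'[of "\<lambda>t. W t \<omega>" 0 q s, OF _ _ _ cs] assms by force
  qed
  then obtain t where t: "t \<in> {0..s}" "W t \<omega> \<in> {p, q}" by auto
  then have "t < s" using ns by (cases "t = s") auto
  then show False using before_exit_time[of t p q W \<omega>] t assms(3) by (auto simp: ennreal_lessI)
qed

text \<open>The convention that an unhit set is entered at the lifetime makes this an identity: if
  the killed path never meets \<open>A\<close>, the path leaves \<open>(p, q)\<close> only when it
  leaves \<open>(0, 1)\<close>.\<close>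

lemma entry_time_eq_exit_time:
  assumes "0 \<le> p" "q \<le> 1" and A: "\<And>y. y \<in> {0<..<1} \<Longrightarrow> y \<in> A \<longleftrightarrow> y \<notin> {p<..<q}"
  shows "entry_time W A \<omega> = exit_time p q W \<omega>"
proof -
  define S where "S = {t. killed W t \<omega> \<in> Some ` A}"
  have S: "t \<in> S \<longleftrightarrow> t < lifetime W \<omega> \<and> W (enn2real t) \<omega> \<in> A" for t
    by (auto simp: S_def killed_def)
  have le: "exit_time p q W \<omega> \<le> lifetime W \<omega>"
    unfolding lifetime_eq_exit_time by (rule exit_time_mono) (use assms in auto)
  have lower: "exit_time p q W \<omega> \<le> t" if "t \<in> S" for t
  proof -
    have "t < \<top>" using that S top_greatest by (blast intro: order.strict_trans2)
    then have t: "t = ennreal (enn2real t)" by simp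
    have "W (enn2real t) \<omega> \<in> {0<..<1}"
      using before_exit_time[of "enn2real t" 0 1 W \<omega>] that t S
      by (simp add: lifetime_eq_exit_time)
    then have "W (enn2real t) \<omega> \<notin> {p<..<q}" using A that S by blast
    then show ?thesis using before_exit_time[of "enn2real t" p q W \<omega>] t by force
  qed
  have mem: "exit_time p q W \<omega> \<in> S" if lt: "exit_time p q W \<omega> < lifetime W \<omega>"
  proof -
    have "exit_time p q W \<omega> < \<top>" using lt top_greatest by (rule order.strict_trans2)
    then obtain s where s: "0 \<le> s" "exit_time p q W \<omega> = ennreal s" "W s \<omega> \<notin> {p<..<q}"
      by (rule exit_time_attained)
    then have "W s \<omega> \<in> {0<..<1}"
      using before_exit_time[of s 0 1 W \<omega>] lt by (simp add: lifetime_eq_exit_time)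
    then show ?thesis using A s S lt by auto
  qed
  show ?thesis
  proof (cases "S = {}")
    case True
    then have "\<not> (\<exists>t. killed W t \<omega> \<in> Some ` A)" by (auto simp: S_def)
    then have "entry_time W A \<omega> = lifetime W \<omega>" unfolding entry_time_def by (rule if_not_P)
    with True mem le show ?thesis by fastforce
  next
    case False
    then obtain t where "t \<in> S" by auto
    then have "exit_time p q W \<omega> < lifetime W \<omega>" using lower S by force
    then have "Inf S = exit_time p q W \<omega>" by (intro antisym Inf_lower Inf_greatest mem lower)
    moreover have "\<exists>t. killed W t \<omega> \<in> Some ` A" using False by (auto simp: S_def)
    then have "entry_time W A \<omega> = Inf S" unfolding entry_time_def S_def by (rule if_P)
    ultimately show ?thesis by simp
  qed
qed

lemma position_in_unit_interval:
  assumes "W 0 \<omega> \<in> {0<..<1}" "0 \<le> s" "ennreal s \<le> lifetime W \<omega>"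
  shows "W s \<omega> \<in> {0..1}"
proof (cases "ennreal s < lifetime W \<omega>")
  case True
  then show ?thesis using before_exit_time[of s 0 1 W \<omega>] assms by (simp add: lifetime_eq_exit_time)
next
  case False
  then show ?thesis using exit_time_boundary[of 0 1 s] assms by (auto simp: lifetime_eq_exit_time)
qed

text \<open>At its lifetime the path sits at 0 or 1, where the reward vanishes as it does at the
  cemetery. Up to and including the lifetime, killing is invisible to the reward.\<close>

lemma ext_killed:
  assumes "W 0 \<omega> \<in> {0<..<1}" "0 \<le> s" "ennreal s \<le> lifetime W \<omega>" "\<phi> 0 = 0" "\<phi> 1 = 0"
  shows "ext \<phi> (killed W (ennreal s) \<omega>) = \<phi> (W s \<omega>)"
proof (cases "ennreal s < lifetime W \<omega>")
  case True
  then show ?thesis using assms(2) by (simp add: killed_def ext_def)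
next
  case False
  then show ?thesis using exit_time_boundary[of 0 1 s] assms
    by (auto simp: killed_def ext_def lifetime_eq_exit_time)
qed

text \<open>Reduces the exit event to countably many times up to \<open>t\<close>, which makes it an
  event of the filtration at \<open>t\<close>. The interval shrinks by \<open>1 / (n + 1)\<close>
  because at rational times the path may only come close to the end point that it reaches at
  \<open>s\<close>.\<close>

lemma exit_interval_iff_rational:
  assumes t: "0 \<le> t"
  shows "(\<exists>s\<in>{0..t}. W s \<omega> \<notin> {p<..<q}) \<longleftrightarrow>
    (\<forall>n. \<exists>k\<in>\<rat> \<inter> {0..}. W (min k t) \<omega> \<notin> {p + inverse (real (Suc n))<..<q - inverse (real (Suc n))})"
proof
  assume "\<exists>s\<in>{0..t}. W s \<omega> \<notin> {p<..<q}"
  then obtain s where s: "s \<in> {0..t}" "W s \<omega> \<notin> {p<..<q}" by auto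
  show "\<forall>n. \<exists>k\<in>\<rat> \<inter> {0..}. W (min k t) \<omega> \<notin> {p + inverse (real (Suc n))<..<q - inverse (real (Suc n))}"
  proof
    fix n
    have "s \<in> {0..}" "0 < inverse (real (Suc n))" using s by auto
    then obtain \<delta> where \<delta>: "0 < \<delta>"
      "\<And>u. u \<in> {0..} \<Longrightarrow> dist u s < \<delta> \<Longrightarrow> dist (W u \<omega>) (W s \<omega>) < inverse (real (Suc n))"
      using cont unfolding continuous_on_iff by blast
    \<comment> \<open>\<open>k\<close> may exceed \<open>t\<close>; truncating it to
      \<open>min k t\<close> keeps it within \<open>\<delta>\<close> of
      \<open>s \<le> t\<close>.\<close>
    obtain k where k: "k \<in> \<rat>" "s < k" "k < s + \<delta>" using Rats_dense_in_real[of s "s + \<delta>"] \<delta>(1) by auto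
    then have "dist (W (min k t) \<omega>) (W s \<omega>) < inverse (real (Suc n))"
      using s by (intro \<delta>(2)) (auto simp: dist_real_def min_def)
    then have "W (min k t) \<omega> \<notin> {p + inverse (real (Suc n))<..<q - inverse (real (Suc n))}"
      using s(2) by (auto simp: dist_real_def abs_if split: if_splits)
    then show "\<exists>k\<in>\<rat> \<inter> {0..}. W (min k t) \<omega> \<notin> {p + inverse (real (Suc n))<..<q - inverse (real (Suc n))}"
      using k s by (intro bexI[of _ k]) auto
  qed
next
  assume R: "\<forall>n. \<exists>k\<in>\<rat> \<inter> {0..}. W (min k t) \<omega> \<notin> {p + inverse (real (Suc n))<..<q - inverse (real (Suc n))}"
  show "\<exists>s\<in>{0..t}. W s \<omega> \<notin> {p<..<q}"
  proof (rule ccontr)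
    assume "\<not> (\<exists>s\<in>{0..t}. W s \<omega> \<notin> {p<..<q})"
    then have I: "\<And>s. s \<in> {0..t} \<Longrightarrow> W s \<omega> \<in> {p<..<q}" by blast
    \<comment> \<open>The distance to the end points is continuous and positive on the compact
      \<open>[0, t]\<close>, hence bounded away from 0, so a small enough margin is never
      reached.\<close>
    define d where "d s = min (W s \<omega> - p) (q - W s \<omega>)" for s
    have "continuous_on {0..t} d"
      unfolding d_def by (intro continuous_intros continuous_on_subset[OF cont]) auto
    moreover have "compact {0..t}" "{0..t} \<noteq> {}" using t by auto
    ultimately obtain s0 where s0: "s0 \<in> {0..t}" "\<And>s. s \<in> {0..t} \<Longrightarrow> d s0 \<le> d s"
      using continuous_attains_inf[of "{0..t}" d] by blast
    have "0 < d s0" using I[OF s0(1)] by (auto simp: d_def)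
    then obtain n where n: "inverse (real (Suc n)) < d s0" using reals_Archimedean by blast
    obtain k where k: "k \<in> \<rat> \<inter> {0..}"
      "W (min k t) \<omega> \<notin> {p + inverse (real (Suc n))<..<q - inverse (real (Suc n))}" using R by blast
    have "d s0 \<le> d (min k t)" using k t by (intro s0(2)) auto
    then show False using n k(2) by (auto simp: d_def)
  qed
qed

end

section \<open>Optional stopping for Brownian motion\<close>

text \<open>An \<open>L\<^sup>2\<close> bound gives uniform integrability, here by truncation at
  level \<open>k\<close>. Truncating changes each \<open>X n\<close> by at most
  \<open>(X n)\<^sup>2 / k\<close>, hence its mean by at most \<open>C / k\<close>; bounded
  convergence passes to the limit, and \<open>Y\<close> itself is unchanged once
  \<open>k \<ge> B\<close>.\<close>

lemma (in prob_space) expectation_limit_bounded_L2: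
  fixes X :: "nat \<Rightarrow> 'a \<Rightarrow> real"
  assumes X: "\<And>n. integrable M (X n)" "\<And>n. expectation (X n) = 0"
    and X2: "\<And>n. integrable M (\<lambda>\<omega>. (X n \<omega>)\<^sup>2)" "\<And>n. expectation (\<lambda>\<omega>. (X n \<omega>)\<^sup>2) \<le> C"
    and lim: "AE \<omega> in M. (\<lambda>n. X n \<omega>) \<longlonglongrightarrow> Y \<omega>"
    and Y: "Y \<in> borel_measurable M" "AE \<omega> in M. \<bar>Y \<omega>\<bar> \<le> B"
  shows "expectation Y = 0"
proof -
  have bound: "\<bar>expectation Y\<bar> \<le> C / real k" if k: "0 < k" "B \<le> real k" for k :: nat
  proof -
    define \<phi> where "\<phi> y = max (- real k) (min (real k) y)" for y
    have \<phi>: "\<bar>\<phi> y\<bar> \<le> real k" "\<bar>\<phi> y - y\<bar> \<le> y\<^sup>2 / real k" for y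
    proof -
      show "\<bar>\<phi> y\<bar> \<le> real k" using k(1) by (auto simp: \<phi>_def)
      have "\<bar>\<phi> y - y\<bar> * real k \<le> y\<^sup>2"
      proof (cases "\<bar>y\<bar> \<le> real k")
        case True
        then have "\<phi> y = y" by (auto simp: \<phi>_def)
        then show ?thesis by simp
      next
        case False
        then have "\<bar>\<phi> y - y\<bar> \<le> \<bar>y\<bar>" by (auto simp: \<phi>_def)
        then have "\<bar>\<phi> y - y\<bar> * real k \<le> \<bar>y\<bar> * \<bar>y\<bar>" using False by (intro mult_mono) auto
        then show ?thesis by (simp add: power2_eq_square)
      qed
      then show "\<bar>\<phi> y - y\<bar> \<le> y\<^sup>2 / real k" using k(1) by (simp add: pos_le_divide_eq)
    qed
    have [measurable]: "\<phi> \<in> borel_measurable borel" unfolding \<phi>_def[abs_def] by measurable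
    have Xm[measurable]: "X n \<in> borel_measurable M" for n using X(1) by auto
    have intX: "integrable M (\<lambda>\<omega>. \<phi> (X n \<omega>))" for n
      by (rule integrable_const_bound[where B="real k"]) (use \<phi> in auto)
    have "(\<lambda>n. expectation (\<lambda>\<omega>. \<phi> (X n \<omega>))) \<longlonglongrightarrow> expectation (\<lambda>\<omega>. \<phi> (Y \<omega>))"
    proof (rule integral_dominated_convergence[where w="\<lambda>_. real k"])
      show "AE \<omega> in M. (\<lambda>n. \<phi> (X n \<omega>)) \<longlonglongrightarrow> \<phi> (Y \<omega>)"
        using lim by eventually_elim (auto simp: \<phi>_def intro!: tendsto_intros)
    qed (use \<phi> Y in auto)
    moreover have "\<bar>expectation (\<lambda>\<omega>. \<phi> (X n \<omega>))\<bar> \<le> C / real k" for n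
    proof -
      have "\<bar>expectation (\<lambda>\<omega>. \<phi> (X n \<omega>))\<bar> = \<bar>expectation (\<lambda>\<omega>. \<phi> (X n \<omega>) - X n \<omega>)\<bar>"
        using X intX by simp
      also have "\<dots> \<le> expectation (\<lambda>\<omega>. \<bar>\<phi> (X n \<omega>) - X n \<omega>\<bar>)" by (rule integral_abs_bound)
      also have "\<dots> \<le> expectation (\<lambda>\<omega>. (X n \<omega>)\<^sup>2 / real k)"
        using X intX X2 \<phi> by (intro integral_mono) auto
      also have "\<dots> \<le> C / real k" using X2 k by (simp add: divide_right_mono)
      finally show ?thesis .
    qed
    ultimately have "\<bar>expectation (\<lambda>\<omega>. \<phi> (Y \<omega>))\<bar> \<le> C / real k"
      by (intro LIMSEQ_le_const2[OF tendsto_rabs]) auto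
    moreover have "expectation (\<lambda>\<omega>. \<phi> (Y \<omega>)) = expectation Y"
    proof (rule integral_cong_AE)
      show "AE \<omega> in M. \<phi> (Y \<omega>) = Y \<omega>"
        using Y(2) by eventually_elim (use k in \<open>auto simp: \<phi>_def\<close>)
    qed (use Y in auto)
    ultimately show ?thesis by simp
  qed
  have "(\<lambda>k. C / real k) \<longlonglongrightarrow> 0" by (rule lim_const_over_n)
  moreover have "eventually (\<lambda>k. \<bar>expectation Y\<bar> \<le> C / real k) sequentially"
    using eventually_gt_at_top[of 0] eventually_ge_at_top[of "nat \<lceil>B\<rceil>"]
    by eventually_elim (rule bound, simp, linarith)
  ultimately have "\<bar>expectation Y\<bar> \<le> 0" by (rule tendsto_lowerbound) simp
  then show ?thesis by simp
qed

text \<open>Stopping a walk at \<open>m\<close> as a transform of its increments: the stake is 1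
  before \<open>m\<close> and 0 afterwards.\<close>

lemma sum_increments_until:
  fixes w :: "nat \<Rightarrow> real"
  shows "(\<Sum>j<K. (w (Suc j) - w j) * of_bool (j < m)) = w (min K m) - w 0"
  by (induction K) (auto simp: min_def not_less dest: le_antisym)

text \<open>Rounding is upwards so that the rounded time is again a stopping time: whether step
  \<open>j\<close> is still to be taken depends only on whether \<open>j / (n + 1) < x\<close>,
  which is known at time \<open>j / (n + 1)\<close>.\<close>

lemma tendsto_grid_ceiling:
  assumes "0 \<le> (x::real)"
  shows "(\<lambda>n. real (nat \<lceil>x * real (Suc n)\<rceil>) / real (Suc n)) \<longlonglongrightarrow> x"
proof -
  have "\<bar>real (nat \<lceil>x * real (Suc n)\<rceil>) / real (Suc n) - x\<bar> \<le> inverse (real (Suc n))" for n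
  proof -
    have "real (nat \<lceil>x * real (Suc n)\<rceil>) = of_int \<lceil>x * real (Suc n)\<rceil>" using assms by simp
    then have "\<bar>real (nat \<lceil>x * real (Suc n)\<rceil>) - x * real (Suc n)\<bar> \<le> 1" by linarith
    then have "\<bar>real (nat \<lceil>x * real (Suc n)\<rceil>) - x * real (Suc n)\<bar> / real (Suc n) \<le> 1 / real (Suc n)"
      by (rule divide_right_mono) simp
    moreover have "\<bar>real (nat \<lceil>x * real (Suc n)\<rceil>) - x * real (Suc n)\<bar> / real (Suc n)
        = \<bar>real (nat \<lceil>x * real (Suc n)\<rceil>) / real (Suc n) - x\<bar>"
      by (simp add: diff_divide_distrib[symmetric] divide_simps abs_divide del: of_nat_Suc)
    ultimately show ?thesis by (simp add: inverse_eq_divide)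
  qed
  then have "(\<lambda>n. real (nat \<lceil>x * real (Suc n)\<rceil>) / real (Suc n) - x) \<longlonglongrightarrow> 0"
    by (intro Lim_null_comparison[OF _ LIMSEQ_inverse_real_of_nat]) auto
  then show ?thesis using LIM_zero_iff by blast
qed

lemma borel_measurable_at_random_time:
  fixes W :: "real \<Rightarrow> 'w \<Rightarrow> real"
  assumes W: "\<And>t. 0 \<le> t \<Longrightarrow> W t \<in> borel_measurable N"
    and cont: "\<And>\<omega>. \<omega> \<in> space N \<Longrightarrow> continuous_on {0..} (\<lambda>t. W t \<omega>)"
    and [measurable]: "R \<in> borel_measurable N" and nonneg: "\<And>\<omega>. 0 \<le> R \<omega>"
  shows "(\<lambda>\<omega>. W (R \<omega>) \<omega>) \<in> borel_measurable N"
proof (rule borel_measurable_LIMSEQ_real)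
  show "(\<lambda>\<omega>. W (real (nat \<lceil>R \<omega> * real (Suc n)\<rceil>) / real (Suc n)) \<omega>) \<in> borel_measurable N" for n
    by (rule measurable_compose_countable[where f="\<lambda>i. W (real i / real (Suc n))"])
      (auto intro!: W)
  fix \<omega> assume "\<omega> \<in> space N"
  then show "(\<lambda>n. W (real (nat \<lceil>R \<omega> * real (Suc n)\<rceil>) / real (Suc n)) \<omega>) \<longlonglongrightarrow> W (R \<omega>) \<omega>"
    by (intro continuous_on_tendsto_compose[OF cont tendsto_grid_ceiling])
      (simp_all only: atLeast_iff nonneg of_nat_0_le_iff divide_nonneg_nonneg eventually_True)
qed

subsection \<open>Completed filtration and exit times\<close>

context brownian_family
begin

lemma sets_P [measurable_cong, simp]: "sets (P x) = sets M"
  and prob_space_P: "prob_space (P x)"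
  using measurable_space[OF kernel, of x] by (auto simp: space_prob_algebra)

lemma space_P [simp]: "space (P x) = space M"
  by (rule sets_eq_imp_space_eq) simp

lemma space_universal_completion [simp]: "space (universal_completion M F P t) = space M"
  by (simp add: universal_completion_def space_measure_of_conv)

text \<open>The sets that differ from a member of \<open>F t\<close> only inside a null set form a
  sigma-algebra, and it contains all generators of the augmentation.\<close>

lemma augmentation_approx:
  assumes "A \<in> sets (augmentation M F (P x) t)"
  shows "\<exists>B\<in>sets (F t). \<exists>N\<in>null_sets (P x). (A - B) \<union> (B - A) \<subseteq> N"
proof -
  have sub: "sets (F t) \<union> {N. \<exists>N'\<in>null_sets (P x). N \<subseteq> N'} \<subseteq> Pow (space M)"
    using sets.space_closed[of "F t"] sets.sets_into_space[of _ "P x"]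
    by (auto simp: space_F null_sets_def)
  have "A \<in> sigma_sets (space M) (sets (F t) \<union> {N. \<exists>N'\<in>null_sets (P x). N \<subseteq> N'})"
    using assms unfolding augmentation_def by (simp add: sets_measure_of[OF sub])
  then show ?thesis
  proof induction
    case (Basic A)
    then show ?case
    proof
      assume "A \<in> sets (F t)"
      then show ?thesis by (intro bexI[of _ A] bexI[of _ "{}"]) auto
    next
      assume "A \<in> {N. \<exists>N'\<in>null_sets (P x). N \<subseteq> N'}"
      then obtain N where "N \<in> null_sets (P x)" "A \<subseteq> N" by auto
      then show ?thesis by (intro bexI[of _ "{}"] bexI[of _ N]) auto
    qed
  next
    case Empty
    show ?case by (intro bexI[of _ "{}"]) auto
  next
    case (Compl A)
    then obtain B N where B: "B \<in> sets (F t)" "N \<in> null_sets (P x)" "(A - B) \<union> (B - A) \<subseteq> N" by blast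
    have "space (F t) - B \<in> sets (F t)" using B(1) by blast
    then show ?case using B(2,3)
      by (intro bexI[of _ "space (F t) - B"] bexI[of _ N]) (auto simp: space_F)
  next
    case (Union A)
    then obtain B N where B: "\<And>i::nat. B i \<in> sets (F t)" "\<And>i. N i \<in> null_sets (P x)"
      "\<And>i. (A i - B i) \<union> (B i - A i) \<subseteq> N i" by metis
    have "(\<Union>i. N i) \<in> null_sets (P x)" using B by (intro null_sets_UN) auto
    moreover have "(\<Union>i. B i) \<in> sets (F t)" using B by auto
    moreover have "((\<Union>i. A i) - (\<Union>i. B i)) \<union> ((\<Union>i. B i) - (\<Union>i. A i)) \<subseteq> (\<Union>i. N i)"
    proof
      fix \<omega> assume "\<omega> \<in> ((\<Union>i. A i) - (\<Union>i. B i)) \<union> ((\<Union>i. B i) - (\<Union>i. A i))"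
      then obtain i where "\<omega> \<in> (A i - B i) \<union> (B i - A i)" by blast
      with B(3)[of i] show "\<omega> \<in> (\<Union>i. N i)" by blast
    qed
    ultimately show ?case by blast
  qed
qed

text \<open>The point mass at \<open>x\<close> is one of the initial laws over which the
  intersection is taken, and its mixture is \<open>P x\<close>.\<close>

lemma universal_completion_subset_augmentation: "sets (universal_completion M F P t) \<subseteq> sets (augmentation M F (P x) t)"
proof -
  have "return borel x \<in> space (prob_algebra borel)"
    by (simp add: space_prob_algebra prob_space_return)
  moreover have "return borel x \<bind> P = P x"
    by (rule bind_return[OF measurable_prob_algebraD[OF kernel]]) simp
  ultimately have sub: "(\<Inter>\<mu>\<in>space (prob_algebra borel). sets (augmentation M F (\<mu> \<bind> P) t))
      \<subseteq> sets (augmentation M F (P x) t)"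
    by (metis INT_lower)
  have sp: "space (augmentation M F (P x) t) = space M" by (simp add: augmentation_def space_measure_of_conv)
  have "sets (augmentation M F (P x) t) \<subseteq> Pow (space M)"
    using sets.space_closed[of "augmentation M F (P x) t"] sp by simp
  then have "sets (universal_completion M F P t) = sigma_sets (space M)
      (\<Inter>\<mu>\<in>space (prob_algebra borel). sets (augmentation M F (\<mu> \<bind> P) t))"
    unfolding universal_completion_def using sub by (intro sets_measure_of) blast
  also have "\<dots> \<subseteq> sets (augmentation M F (P x) t)"
    using sigma_sets_le_sets_iff[of "augmentation M F (P x) t"] sub sp by simp
  finally show ?thesis .
qed

lemma universal_completion_approx:
  assumes "A \<in> sets (universal_completion M F P t)"
  obtains B where "B \<in> sets (F t)" "AE \<omega> in P x. \<omega> \<in> A \<longleftrightarrow> \<omega> \<in> B"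
proof -
  obtain B N where B: "B \<in> sets (F t)" "N \<in> null_sets (P x)" "(A - B) \<union> (B - A) \<subseteq> N"
    using augmentation_approx[OF subsetD[OF universal_completion_subset_augmentation assms]] by blast
  have "AE \<omega> in P x. \<omega> \<in> A \<longleftrightarrow> \<omega> \<in> B" by (rule AE_I'[OF B(2)]) (use B(3) in auto)
  with B(1) show thesis by (rule that)
qed

lemma universal_completion_subset_completion: "sets (universal_completion M F P t) \<subseteq> sets (completion (P x))"
proof
  fix A assume A: "A \<in> sets (universal_completion M F P t)"
  obtain B N where B: "B \<in> sets (F t)" "N \<in> null_sets (P x)" "(A - B) \<union> (B - A) \<subseteq> N"
    using augmentation_approx[OF subsetD[OF universal_completion_subset_augmentation A]] by blast
  have "B \<in> sets (completion (P x))" using B(1) sub_algebra[of t] by (auto intro!: sets_completionI_sets)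
  moreover have "A - B \<in> sets (completion (P x))" "B - A \<in> sets (completion (P x))"
    using B by (auto intro!: null_sets_completion[OF B(2)])
  ultimately have "(B - (B - A)) \<union> (A - B) \<in> sets (completion (P x))" by blast
  moreover have "(B - (B - A)) \<union> (A - B) = A" by blast
  ultimately show "A \<in> sets (completion (P x))" by simp
qed

lemma F_subset_universal_completion: "sets (F t) \<subseteq> sets (universal_completion M F P t)"
proof
  fix A assume A: "A \<in> sets (F t)"
  have sub: "sets (F t) \<union> {N. \<exists>N'\<in>null_sets Q. N \<subseteq> N'} \<subseteq> Pow (space M)"
    if "Q \<in> (\<lambda>\<mu>. \<mu> \<bind> P) ` space (prob_algebra borel)" for Q
  proof -
    have "sets Q = sets M"
      using that by (auto intro!: sets_bind[where N=M] dest: prob_space.not_empty simp: space_prob_algebra)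
    then have "N \<subseteq> space M" if "N \<in> null_sets Q" for N
      using null_setsD2[OF that] sets.sets_into_space by metis
    then show ?thesis using sets.space_closed[of "F t"] by (auto simp: space_F)
  qed
  have 1: "A \<in> sets (augmentation M F (\<mu> \<bind> P) t)" if "\<mu> \<in> space (prob_algebra borel)" for \<mu>
    unfolding augmentation_def using A by (subst sets_measure_of[OF sub]) (use that in auto)
  have "(\<Inter>\<mu>\<in>space (prob_algebra borel). sets (augmentation M F (\<mu> \<bind> P) t)) \<subseteq> Pow (space M)"
  proof -
    have "return borel (0::real) \<in> space (prob_algebra borel)"
      by (simp add: space_prob_algebra prob_space_return)
    moreover have "sets (augmentation M F Q t) \<subseteq> Pow (space M)" for Q
      using sets.space_closed[of "augmentation M F Q t"] by (simp add: augmentation_def space_measure_of_conv)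
    ultimately show ?thesis by blast
  qed
  then show "A \<in> sets (universal_completion M F P t)"
    unfolding universal_completion_def using 1 by (subst sets_measure_of) auto
qed

lemma stopping_times_measurable:
  assumes "\<tau> \<in> stopping_times M F P"
  shows "\<tau> \<in> borel_measurable (completion (P x))"
proof (rule measurable_stopping_time)
  show "stopping_time (universal_completion M F P) \<tau>" using assms by (simp add: stopping_times_def)
qed (use universal_completion_subset_completion in simp_all)

lemma stopping_times_gt:
  assumes "\<tau> \<in> stopping_times M F P"
  shows "{\<omega>\<in>space M. t < \<tau> \<omega>} \<in> sets (universal_completion M F P t)"
  using stopping_timeD2[of "universal_completion M F P" \<tau> t] assms
  by (simp add: stopping_times_def pred_def)

lemma stopping_times_min:
  "\<tau> \<in> stopping_times M F P \<Longrightarrow> \<sigma> \<in> stopping_times M F P \<Longrightarrow> (\<lambda>\<omega>. min (\<tau> \<omega>) (\<sigma> \<omega>)) \<in> stopping_times M F P"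
  by (simp add: stopping_times_def stopping_time_min)

lemma W_measurable: "0 \<le> t \<Longrightarrow> W t \<in> borel_measurable M"
  using adapted[of t] sub_algebra[of "ennreal t"] space_F[of "ennreal t"]
  by (meson measurable_from_subalg subalgebra_def)

lemma W_measurable_completion: "0 \<le> t \<Longrightarrow> W t \<in> borel_measurable (completion (P x))"
  using W_measurable[of t] by (auto intro!: measurable_completion cong: measurable_cong_sets)

text \<open>The exit event lies in \<open>F t\<close> even before completion. Agreement of
  \<open>\<tau>\<close> with the exit time is asked on \<open>space M\<close> only, since elsewhere
  the paths need not be continuous and entry and exit times may differ.\<close>

lemma exit_time_stopping:
  assumes "\<And>\<omega>. \<omega> \<in> space M \<Longrightarrow> \<tau> \<omega> = exit_time p q W \<omega>"
  shows "\<tau> \<in> stopping_times M F P"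
  unfolding stopping_times_def stopping_time_def
proof safe
  fix t :: ennreal
  have "Measurable.pred (F t) (\<lambda>\<omega>. exit_time p q W \<omega> \<le> t)"
  proof (cases t)
    case top
    then show ?thesis by simp
  next
    case (real r)
    have W: "W (min k r) \<in> borel_measurable (F t)" if "k \<in> \<rat> \<inter> {0..}" for k
      using that real sets_F_mono[of "ennreal (min k r)" t] space_F adapted[of "min k r"]
      by (intro measurable_from_subalg[of "F t" "F (ennreal (min k r))"])
        (auto simp: subalgebra_def intro!: ennreal_leI)
    have "countable (\<rat> \<inter> {0::real..})" by (simp add: countable_rat countable_Int1)
    then have "(\<Union>k\<in>\<rat> \<inter> {0..}. W (min k r) -` (- {p + inverse (real (Suc n))<..<q - inverse (real (Suc n))})
        \<inter> space (F t)) \<in> sets (F t)" for n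
      by (rule sets.countable_UN') (auto intro!: measurable_sets[OF W])
    then have "Measurable.pred (F t) (\<lambda>\<omega>. \<exists>k\<in>\<rat> \<inter> {0..}.
        W (min k r) \<omega> \<notin> {p + inverse (real (Suc n))<..<q - inverse (real (Suc n))})" for n
      unfolding pred_def
      by (rule back_subst[where P="\<lambda>A. A \<in> sets (F t)"]) auto
    then have "Measurable.pred (F t) (\<lambda>\<omega>. \<forall>n. \<exists>k\<in>\<rat> \<inter> {0..}.
        W (min k r) \<omega> \<notin> {p + inverse (real (Suc n))<..<q - inverse (real (Suc n))})"
      by (rule pred_intros_countable)
    moreover have "(\<forall>n. \<exists>k\<in>\<rat> \<inter> {0..}.
        W (min k r) \<omega> \<notin> {p + inverse (real (Suc n))<..<q - inverse (real (Suc n))})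
        \<longleftrightarrow> exit_time p q W \<omega> \<le> t" if "\<omega> \<in> space (F t)" for \<omega>
      using that real space_F continuous_paths
        exit_time_le_iff[of W \<omega> r p q] exit_interval_iff_rational[of W \<omega> r p q] by simp
    ultimately show ?thesis by (simp cong: measurable_cong)
  qed
  then have "{\<omega>\<in>space M. exit_time p q W \<omega> \<le> t} \<in> sets (universal_completion M F P t)"
    using F_subset_universal_completion by (auto simp: pred_def space_F)
  moreover have "{\<omega>\<in>space M. exit_time p q W \<omega> \<le> t} = {\<omega>\<in>space M. \<tau> \<omega> \<le> t}"
    using assms by auto
  ultimately show "Measurable.pred (universal_completion M F P t) (\<lambda>\<omega>. \<tau> \<omega> \<le> t)"
    by (simp add: pred_def)
qed

section \<open>Increments and martingale transforms\<close>

lemma increment_moments: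
  assumes "0 \<le> s" "s < t"
  shows "integrable (P x) (\<lambda>\<omega>. W t \<omega> - W s \<omega>)"
    and "(LINT \<omega>|P x. W t \<omega> - W s \<omega>) = 0"
    and "integrable (P x) (\<lambda>\<omega>. (W t \<omega> - W s \<omega>)\<^sup>2)"
    and "(LINT \<omega>|P x. (W t \<omega> - W s \<omega>)\<^sup>2) = t - s"
proof -
  interpret prob_space "P x" by (rule prob_space_P)
  note D = gaussian_increments[OF assms, of x]
  have pos: "0 < sqrt (t - s)" using assms by simp
  show "integrable (P x) (\<lambda>\<omega>. W t \<omega> - W s \<omega>)"
    using distributed_integrable[OF D, of "\<lambda>y. y"] integrable_normal_moment[OF pos, of 0 1] by simp
  show 1: "(LINT \<omega>|P x. W t \<omega> - W s \<omega>) = 0"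
    by (rule normal_distributed_expectation[OF pos D])
  show "integrable (P x) (\<lambda>\<omega>. (W t \<omega> - W s \<omega>)\<^sup>2)"
    using distributed_integrable[OF D, of "\<lambda>y. y\<^sup>2"] integrable_normal_moment[OF pos, of 0 2] by simp
  show "(LINT \<omega>|P x. (W t \<omega> - W s \<omega>)\<^sup>2) = t - s"
    using normal_distributed_variance[OF pos D] 1 assms by simp
qed

text \<open>Independence transferred to functions of the past and of the increment. Both the
  increment itself, whose mean 0 kills cross terms, and its square are inserted for
  \<open>\<phi>\<close>.\<close>

lemma increment_orthogonal:
  fixes X :: "'w \<Rightarrow> real" and \<phi> :: "real \<Rightarrow> real"
  assumes "0 \<le> s" "s < t" and X: "X \<in> borel_measurable (F (ennreal s))" "integrable (P x) X"
    and \<xi>: "\<phi> \<in> borel_measurable borel" "integrable (P x) (\<lambda>\<omega>. \<phi> (W t \<omega> - W s \<omega>))"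
  shows "integrable (P x) (\<lambda>\<omega>. X \<omega> * \<phi> (W t \<omega> - W s \<omega>))"
    and "(LINT \<omega>|P x. X \<omega> * \<phi> (W t \<omega> - W s \<omega>))
      = (LINT \<omega>|P x. X \<omega>) * (LINT \<omega>|P x. \<phi> (W t \<omega> - W s \<omega>))"
proof -
  interpret prob_space "P x" by (rule prob_space_P)
  define I where "I \<omega> = W t \<omega> - W s \<omega>" for \<omega>
  have I: "I \<in> borel_measurable M" unfolding I_def using assms W_measurable by auto
  have XM: "X \<in> borel_measurable M"
    using X(1) sub_algebra space_F by (meson measurable_from_subalg subalgebra_def)
  have ind: "indep_set (sets (F (ennreal s))) (sets (vimage_algebra (space M) I borel))"
    unfolding I_def by (rule independent_increments[OF assms(1,2)])
  have sX: "sigma_sets (space M) {X -` A \<inter> space M |A. A \<in> sets borel} \<subseteq> sets (F (ennreal s))"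
    using measurable_sets[OF X(1)] space_F[of "ennreal s"]
    by (intro sets.sigma_sets_subset[of _ "F (ennreal s)", simplified space_F]) auto
  have s\<phi>: "sigma_sets (space M) {(\<lambda>\<omega>. \<phi> (I \<omega>)) -` A \<inter> space M |A. A \<in> sets borel}
      \<subseteq> sets (vimage_algebra (space M) I borel)"
  proof -
    have "(\<lambda>\<omega>. \<phi> (I \<omega>)) -` A \<inter> space M \<in> sets (vimage_algebra (space M) I borel)"
      if "A \<in> sets borel" for A
    proof -
      have "\<phi> -` A \<in> sets borel" using measurable_sets[OF \<xi>(1) that] by simp
      then have "I -` (\<phi> -` A) \<inter> space M \<in> sets (vimage_algebra (space M) I borel)"
        by (rule in_vimage_algebra)
      then show ?thesis by (simp add: vimage_def)
    qed
    then show ?thesis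
      by (intro sets.sigma_sets_subset[of _ "vimage_algebra (space M) I borel", simplified]) auto
  qed
  have "indep_var borel X borel (\<lambda>\<omega>. \<phi> (I \<omega>))"
    unfolding indep_var_eq
  proof (intro conjI)
    show "X \<in> borel_measurable (P x)" "(\<lambda>\<omega>. \<phi> (I \<omega>)) \<in> borel_measurable (P x)"
      using XM I \<xi>(1) by (auto cong: measurable_cong_sets)
    show "indep_set (sigma_sets (space (P x)) {X -` A \<inter> space (P x) |A. A \<in> sets borel})
      (sigma_sets (space (P x)) {(\<lambda>\<omega>. \<phi> (I \<omega>)) -` A \<inter> space (P x) |A. A \<in> sets borel})"
      using ind sX s\<phi> unfolding indep_set_def
      by (elim indep_sets_mono_sets) (auto split: bool.split)
  qed
  note ind = this[unfolded I_def]
  show "integrable (P x) (\<lambda>\<omega>. X \<omega> * \<phi> (W t \<omega> - W s \<omega>))"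
    by (rule indep_var_integrable[OF ind X(2) \<xi>(2)])
  show "(LINT \<omega>|P x. X \<omega> * \<phi> (W t \<omega> - W s \<omega>))
      = (LINT \<omega>|P x. X \<omega>) * (LINT \<omega>|P x. \<phi> (W t \<omega> - W s \<omega>))"
    by (rule indep_var_lebesgue_integral[OF ind X(2) \<xi>(2)])
qed

subsection \<open>Optional stopping\<close>

text \<open>The stake \<open>B j\<close> is known when step \<open>j\<close> begins, so each step
  adds mean 0 and is orthogonal to the past. The second moment grows by at most \<open>h\<close> per
  step, so it is bounded by the elapsed time whatever the grid width.\<close>

lemma martingale_transform:
  assumes h: "0 < h" and B: "\<And>j. B j \<in> sets (F (ennreal (real j * h)))"
  defines "S \<equiv> \<lambda>k \<omega>. \<Sum>j<k. (W (real (Suc j) * h) \<omega> - W (real j * h) \<omega>) * indicator (B j) \<omega>"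
  shows "integrable (P x) (S k)" "(LINT \<omega>|P x. S k \<omega>) = 0"
    "integrable (P x) (\<lambda>\<omega>. (S k \<omega>)\<^sup>2)" "(LINT \<omega>|P x. (S k \<omega>)\<^sup>2) \<le> real k * h"
proof -
  interpret prob_space "P x" by (rule prob_space_P)
  define \<xi> where "\<xi> j \<omega> = W (real (Suc j) * h) \<omega> - W (real j * h) \<omega>" for j \<omega>
  have t: "0 \<le> real j * h" "real j * h < real (Suc j) * h" for j using h by auto
  have mono: "sets (F (ennreal (real i * h))) \<subseteq> sets (F (ennreal (real j * h)))" if "i \<le> j" for i j
    using that h by (intro sets_F_mono ennreal_leI mult_right_mono) auto
  have Wm: "W (real i * h) \<in> borel_measurable (F (ennreal (real j * h)))" if "i \<le> j" for i j
    using mono[OF that] space_F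
    by (intro measurable_from_subalg[OF _ adapted[OF t(1)[of i]]]) (simp add: subalgebra_def)
  have Bm: "B i \<in> sets (F (ennreal (real j * h)))" if "i \<le> j" for i j
    using B[of i] mono[OF that] by auto
  have Sm: "S k \<in> borel_measurable (F (ennreal (real k * h)))" for k
    unfolding S_def
    by (intro borel_measurable_sum borel_measurable_times borel_measurable_diff Wm
        borel_measurable_indicator Bm) auto
  have Im: "(\<lambda>\<omega>. indicat_real (B k) \<omega>) \<in> borel_measurable (F (ennreal (real k * h)))" for k
    by (intro borel_measurable_indicator Bm) auto
  have subM: "f \<in> borel_measurable (P x)" if "f \<in> borel_measurable (F t)" for f :: "'w \<Rightarrow> real" and t
    using that sub_algebra[of t] space_F
    by (intro measurable_from_subalg[of "P x" "F t"]) (auto simp: subalgebra_def)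
  have I: "integrable (P x) (indicat_real (B k))" for k
    by (intro integrable_const_bound[where B=1, OF _ subM[OF Im]]) (simp add: indicator_def)
  note mom = increment_moments[OF t, of x, folded \<xi>_def]
  note orth = increment_orthogonal[OF t, of _ _ x, folded \<xi>_def]
  have step: "S (Suc k) \<omega> = S k \<omega> + indicator (B k) \<omega> * \<xi> k \<omega>" for k \<omega>
    by (simp only: S_def \<xi>_def sum.lessThan_Suc mult.commute[of "indicator _ _"])
  \<comment> \<open>The square of an indicator is the indicator itself, hence the last term.\<close>
  have step2: "(S (Suc k) \<omega>)\<^sup>2 = (S k \<omega>)\<^sup>2 + 2 * ((S k \<omega> * indicator (B k) \<omega>) * \<xi> k \<omega>)
      + indicator (B k) \<omega> * (\<xi> k \<omega>)\<^sup>2" for k \<omega>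
    by (simp add: step power2_eq_square algebra_simps indicator_def)
  have "integrable (P x) (S k) \<and> (LINT \<omega>|P x. S k \<omega>) = 0 \<and>
    integrable (P x) (\<lambda>\<omega>. (S k \<omega>)\<^sup>2) \<and> (LINT \<omega>|P x. (S k \<omega>)\<^sup>2) \<le> real k * h"
  proof (induction k)
    case 0
    show ?case by (simp add: S_def)
  next
    case (Suc k)
    have SB: "integrable (P x) (\<lambda>\<omega>. S k \<omega> * indicator (B k) \<omega>)"
      using integrable_real_mult_indicator[of "B k" "P x" "S k"] Suc Bm[of k k] sub_algebra by auto
    have 1: "integrable (P x) (\<lambda>\<omega>. indicator (B k) \<omega> * \<xi> k \<omega>)"
      "(LINT \<omega>|P x. indicator (B k) \<omega> * \<xi> k \<omega>) = 0"
      using orth[OF Im I, of "\<lambda>y. y" k] mom by auto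
    have 2: "integrable (P x) (\<lambda>\<omega>. (S k \<omega> * indicator (B k) \<omega>) * \<xi> k \<omega>)"
      "(LINT \<omega>|P x. (S k \<omega> * indicator (B k) \<omega>) * \<xi> k \<omega>) = 0"
      using orth[OF borel_measurable_times[OF Sm Im] SB, of "\<lambda>y. y"] mom by auto
    have 3: "integrable (P x) (\<lambda>\<omega>. indicator (B k) \<omega> * (\<xi> k \<omega>)\<^sup>2)"
      using orth(1)[OF Im I, of "\<lambda>y. y\<^sup>2" k] mom by auto
    have "(LINT \<omega>|P x. indicator (B k) \<omega> * (\<xi> k \<omega>)\<^sup>2) \<le> (LINT \<omega>|P x. (\<xi> k \<omega>)\<^sup>2)"
      by (intro integral_mono 3 mom) (auto simp: indicator_def)
    also have "\<dots> = h" using mom(4)[of k] by (simp add: algebra_simps)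
    finally have 4: "(LINT \<omega>|P x. indicator (B k) \<omega> * (\<xi> k \<omega>)\<^sup>2) \<le> h" .
    have "(LINT \<omega>|P x. (S (Suc k) \<omega>)\<^sup>2)
        = (LINT \<omega>|P x. (S k \<omega>)\<^sup>2) + (LINT \<omega>|P x. indicator (B k) \<omega> * (\<xi> k \<omega>)\<^sup>2)"
      unfolding step2 using Suc 2 3 by simp
    also have "\<dots> \<le> real (Suc k) * h" using 4 Suc by (simp add: algebra_simps)
    finally show ?case
      unfolding step2 unfolding step using Suc 1 2 3 by simp
  qed
  then show "integrable (P x) (S k)" "(LINT \<omega>|P x. S k \<omega>) = 0"
    "integrable (P x) (\<lambda>\<omega>. (S k \<omega>)\<^sup>2)" "(LINT \<omega>|P x. (S k \<omega>)\<^sup>2) \<le> real k * h"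
    by blast+
qed

text \<open>A path that stays in \<open>(0, 1)\<close> forever has all its increments from time 0 in
  \<open>[-1, 1]\<close>. The normal density of variance \<open>n + 1\<close> is at most
  \<open>1 / sqrt (2 * pi * (n + 1))\<close> and the interval has length 2, so the probability of
  this at time \<open>n + 1\<close> tends to 0.\<close>

lemma lifetime_finite: "AE \<omega> in P x. lifetime W \<omega> < \<top>"
proof -
  interpret prob_space "P x" by (rule prob_space_P)
  define A where "A n = (\<lambda>\<omega>. W (real (Suc n)) \<omega> - W 0 \<omega>) -` {-1..1} \<inter> space (P x)" for n
  have Am: "A n \<in> sets (P x)" for n
    unfolding A_def using W_measurable[of "real (Suc n)"] W_measurable[of 0]
    by (intro measurable_sets[OF borel_measurable_diff]) (auto cong: measurable_cong_sets)
  have bound: "emeasure (P x) (A n) \<le> ennreal (2 / sqrt (2 * pi * real (Suc n)))" for n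
  proof -
    have D: "distributed (P x) lborel (\<lambda>\<omega>. W (real (Suc n)) \<omega> - W 0 \<omega>) (normal_density 0 (sqrt (real (Suc n))))"
      using gaussian_increments[of 0 "real (Suc n)" x] by simp
    have dens: "normal_density 0 (sqrt (real (Suc n))) y \<le> 1 / sqrt (2 * pi * real (Suc n))" for y
      unfolding normal_density_def by (simp add: divide_right_mono)
    have "emeasure (P x) (A n)
        = (\<integral>\<^sup>+y. ennreal (normal_density 0 (sqrt (real (Suc n))) y) * indicator {-1..1} y \<partial>lborel)"
      unfolding A_def by (rule distributed_emeasure[OF D]) simp
    also have "\<dots> \<le> (\<integral>\<^sup>+y. ennreal (1 / sqrt (2 * pi * real (Suc n))) * indicator {-1..1::real} y \<partial>lborel)"
      by (intro nn_integral_mono mult_right_mono ennreal_leI dens) simp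
    also have "\<dots> = ennreal (1 / sqrt (2 * pi * real (Suc n))) * 2"
      by (subst nn_integral_cmult_indicator) auto
    also have "\<dots> = ennreal (2 / sqrt (2 * pi * real (Suc n)))"
      by (simp add: ennreal_mult'[symmetric] ennreal_numeral[symmetric] del: ennreal_numeral)
    finally show ?thesis .
  qed
  have "(\<lambda>n. ennreal (2 / sqrt (2 * pi * real (Suc n)))) \<longlonglongrightarrow> ennreal 0"
  proof (rule tendsto_ennrealI)
    have "filterlim (\<lambda>n. sqrt (2 * pi * real (Suc n))) at_top sequentially"
      by (intro filterlim_compose[OF sqrt_at_top] filterlim_tendsto_pos_mult_at_top[OF tendsto_const]
          filterlim_compose[OF filterlim_real_sequentially filterlim_Suc]) simp
    then show "(\<lambda>n. 2 / sqrt (2 * pi * real (Suc n))) \<longlonglongrightarrow> 0"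
      by (intro tendsto_divide_0[OF tendsto_const]) (rule filterlim_at_top_imp_at_infinity)
  qed
  moreover have "emeasure (P x) (\<Inter>n. A n) \<le> ennreal (2 / sqrt (2 * pi * real (Suc n)))" for n
    using emeasure_mono[of "\<Inter>n. A n" "A n" "P x"] bound[of n] Am by (meson INT_lower UNIV_I order_trans)
  ultimately have "emeasure (P x) (\<Inter>n. A n) \<le> ennreal 0"
    by (intro LIMSEQ_le_const) auto
  then have null: "(\<Inter>n. A n) \<in> null_sets (P x)" using Am by (auto simp: null_sets_def)
  show ?thesis
  proof (rule AE_I'[OF null], rule subsetI)
    fix \<omega> assume "\<omega> \<in> {\<omega> \<in> space (P x). \<not> lifetime W \<omega> < \<top>}"
    then have "\<omega> \<in> space (P x)" and inf: "lifetime W \<omega> = \<top>"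
      using top.not_eq_extremum[of "lifetime W \<omega>"] by blast+
    have "W t \<omega> \<in> {0<..<1}" if "0 \<le> t" for t
      using before_exit_time[of t 0 1 W \<omega>] that inf by (simp add: lifetime_eq_exit_time)
    note in01 = this
    have "W (real (Suc n)) \<omega> - W 0 \<omega> \<in> {-1..1}" for n
      using in01[of 0] in01[of "real (Suc n)"] by (simp del: of_nat_Suc)
    then show "\<omega> \<in> (\<Inter>n. A n)" using \<open>\<omega> \<in> space (P x)\<close> by (auto simp: A_def)
  qed
qed

text \<open>Where \<open>\<rho>\<close> is infinite, \<open>enn2real\<close> yields 0 and the
  position is the starting point. For times up to the lifetime this happens with probability
  0.\<close>

lemma position_measurable:
  assumes "\<rho> \<in> stopping_times M F P"
  shows "(\<lambda>\<omega>. W (enn2real (\<rho> \<omega>)) \<omega>) \<in> borel_measurable (completion (P x))"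
proof (rule borel_measurable_at_random_time[where W=W and R="\<lambda>\<omega>. enn2real (\<rho> \<omega>)"])
  show "(\<lambda>\<omega>. enn2real (\<rho> \<omega>)) \<in> borel_measurable (completion (P x))"
    using stopping_times_measurable[OF assms] by measurable
qed (use continuous_paths W_measurable_completion in auto)

lemma AE_start:
  assumes "x \<in> {0<..<1}"
  shows "AE \<omega> in P x. \<omega> \<in> space M \<and> W 0 \<omega> = x \<and> W 0 \<omega> \<in> {0<..<1}"
  using start[of x] AE_space by eventually_elim (use assms in auto)

text \<open>The bounded horizon \<open>T\<close> keeps the second moments of the discretised walks
  bounded by \<open>T\<close>, uniformly in the grid.\<close>

lemma optional_stopping_bounded:
  assumes \<rho>: "\<rho> \<in> stopping_times M F P"
    and le: "\<And>\<omega>. \<omega> \<in> space M \<Longrightarrow> \<rho> \<omega> \<le> lifetime W \<omega>"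
    and x: "x \<in> {0<..<1}"
  shows "(LINT \<omega>|completion (P x). W (enn2real (min (\<rho> \<omega>) (ennreal (real T)))) \<omega> - W 0 \<omega>) = 0"
proof -
  interpret P: prob_space "P x" by (rule prob_space_P)
  interpret prob_space "completion (P x)" by (rule P.prob_space_completion)
  define R where "R \<omega> = enn2real (min (\<rho> \<omega>) (ennreal (real T)))" for \<omega>
  have R: "0 \<le> R \<omega>" "R \<omega> \<le> real T" "ennreal (R \<omega>) = min (\<rho> \<omega>) (ennreal (real T))" for \<omega>
  proof -
    have "min (\<rho> \<omega>) (ennreal (real T)) < \<top>" by (simp add: min_less_iff_disj)
    then show eq: "ennreal (R \<omega>) = min (\<rho> \<omega>) (ennreal (real T))" by (simp add: R_def)
    show "0 \<le> R \<omega>" by (simp add: R_def)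
    have "ennreal (R \<omega>) \<le> ennreal (real T)" unfolding eq by simp
    then show "R \<omega> \<le> real T" by simp
  qed
  define \<delta> where "\<delta> n = inverse (real (Suc n))" for n
  have \<delta>: "0 < \<delta> n" for n by (simp add: \<delta>_def)
  have ex: "\<exists>B. B \<in> sets (F (ennreal (real j * \<delta> n))) \<and>
      (AE \<omega> in P x. \<omega> \<in> {\<omega>\<in>space M. ennreal (real j * \<delta> n) < \<rho> \<omega>} \<longleftrightarrow> \<omega> \<in> B)" for n j
    by (rule universal_completion_approx[OF stopping_times_gt[OF \<rho>, of "ennreal (real j * \<delta> n)"], of x]) blast
  \<comment> \<open>These are the stakes: events of the original filtration, to which independence
    of increments applies, equal up to null sets to the events that \<open>\<rho>\<close> lies
    beyond the grid time.\<close>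
  define B where "B n j = (SOME B. B \<in> sets (F (ennreal (real j * \<delta> n))) \<and>
      (AE \<omega> in P x. \<omega> \<in> {\<omega>\<in>space M. ennreal (real j * \<delta> n) < \<rho> \<omega>} \<longleftrightarrow> \<omega> \<in> B))" for n j
  have B: "B n j \<in> sets (F (ennreal (real j * \<delta> n)))"
    "AE \<omega> in P x. \<omega> \<in> {\<omega>\<in>space M. ennreal (real j * \<delta> n) < \<rho> \<omega>} \<longleftrightarrow> \<omega> \<in> B n j" for n j
    using someI_ex[OF ex[of j n], folded B_def] by blast+
  define S where "S n \<omega> = (\<Sum>j<T * Suc n. (W (real (Suc j) * \<delta> n) \<omega> - W (real j * \<delta> n) \<omega>)
    * indicator (B n j) \<omega>)" for n \<omega>
  have S: "integrable (P x) (S n)" "(LINT \<omega>|P x. S n \<omega>) = 0" "integrable (P x) (\<lambda>\<omega>. (S n \<omega>)\<^sup>2)"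
    "(LINT \<omega>|P x. (S n \<omega>)\<^sup>2) \<le> real (T * Suc n) * \<delta> n" for n
    unfolding S_def[abs_def] by (rule martingale_transform[OF \<delta> B(1)])+
  have Sm: "S n \<in> borel_measurable (P x)" for n using S(1) by auto
  have "AE \<omega> in P x. \<forall>n j. \<omega> \<in> {\<omega>\<in>space M. ennreal (real j * \<delta> n) < \<rho> \<omega>} \<longleftrightarrow> \<omega> \<in> B n j"
    using B(2) by (simp add: AE_all_countable)
  then have lim: "AE \<omega> in P x. (\<lambda>n. S n \<omega>) \<longlonglongrightarrow> W (R \<omega>) \<omega> - W 0 \<omega>"
    using AE_space
  proof eventually_elim
    case (elim \<omega>)
    then have \<omega>: "\<omega> \<in> space M" by simp
    have "S n \<omega> = W (real (nat \<lceil>R \<omega> * real (Suc n)\<rceil>) / real (Suc n)) \<omega> - W 0 \<omega>" for n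
    proof -
      define m where "m = nat \<lceil>R \<omega> * real (Suc n)\<rceil>"
      \<comment> \<open>Before the horizon, \<open>\<rho>\<close> and its truncation
        \<open>R\<close> exceed the same grid times, so the stakes can be read off from
        \<open>R\<close>.\<close>
      have ind: "indicator (B n j) \<omega> = (of_bool (j < m) :: real)" if j: "j < T * Suc n" for j
      proof -
        have "real j < real T * real (Suc n)" using j by (metis of_nat_less_iff of_nat_mult)
        then have "real j * \<delta> n < real T"
          by (simp add: \<delta>_def field_simps del: of_nat_Suc)
        moreover have "0 \<le> real j * \<delta> n" using \<delta>[of n] by simp
        ultimately have "ennreal (real j * \<delta> n) < ennreal (real T)" by (intro ennreal_lessI) auto
        then have "ennreal (real j * \<delta> n) < \<rho> \<omega> \<longleftrightarrow> ennreal (real j * \<delta> n) < ennreal (R \<omega>)"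
          unfolding R(3) by simp
        also have "\<dots> \<longleftrightarrow> real j * \<delta> n < R \<omega>"
          using \<open>0 \<le> real j * \<delta> n\<close> by (simp add: ennreal_less_iff)
        also have "\<dots> \<longleftrightarrow> real j < R \<omega> * real (Suc n)"
          by (simp add: \<delta>_def field_simps del: of_nat_Suc)
        also have "\<dots> \<longleftrightarrow> j < m"
          unfolding m_def by (simp add: zless_nat_conj less_ceiling_iff zless_nat_eq_int_zless)
        finally have "\<omega> \<in> B n j \<longleftrightarrow> j < m" using elim \<omega> by blast
        then show ?thesis by (simp add: indicator_def)
      qed
      have "S n \<omega> = (\<Sum>j<T * Suc n. (W (real (Suc j) * \<delta> n) \<omega> - W (real j * \<delta> n) \<omega>) * of_bool (j < m))"
        unfolding S_def by (intro sum.cong refl arg_cong2[where f="(*)"] ind) simp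
      also have "\<dots> = W (real (min (T * Suc n) m) * \<delta> n) \<omega> - W (real 0 * \<delta> n) \<omega>"
        by (rule sum_increments_until[where w="\<lambda>j. W (real j * \<delta> n) \<omega>"])
      \<comment> \<open>\<open>T\<close> is a natural number and hence a grid point, so rounding
        \<open>R \<omega> \<le> T\<close> up does not pass it.\<close>
      also have "m \<le> T * Suc n"
      proof -
        have "R \<omega> * real (Suc n) \<le> real (T * Suc n)" using R(2)[of \<omega>] by (simp add: mult_right_mono del: of_nat_Suc mult_Suc_right)
        then show ?thesis unfolding m_def by (simp add: ceiling_le_iff nat_le_iff del: of_nat_Suc of_nat_mult)
      qed
      then have "min (T * Suc n) m = m" by simp
      finally show ?thesis by (simp add: m_def \<delta>_def divide_inverse)
    qed
    moreover have "(\<lambda>n. W (real (nat \<lceil>R \<omega> * real (Suc n)\<rceil>) / real (Suc n)) \<omega>) \<longlonglongrightarrow> W (R \<omega>) \<omega>"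
      by (intro continuous_on_tendsto_compose[OF continuous_paths[OF \<omega>] tendsto_grid_ceiling])
        (simp_all only: atLeast_iff R of_nat_0_le_iff divide_nonneg_nonneg eventually_True)
    ultimately show ?case by (simp add: tendsto_diff del: of_nat_Suc of_nat_nat)
  qed
  have Rm: "(\<lambda>\<omega>. W (R \<omega>) \<omega>) \<in> borel_measurable (completion (P x))"
  proof (rule borel_measurable_at_random_time[where W=W and R=R])
    show "R \<in> borel_measurable (completion (P x))"
      unfolding R_def[abs_def] using stopping_times_measurable[OF \<rho>] by measurable
  qed (use continuous_paths R W_measurable_completion in auto)
  have W0: "W 0 \<in> borel_measurable (completion (P x))" by (rule W_measurable_completion) simp
  \<comment> \<open>The discretised walk may overshoot the unit interval, so it is only bounded in \<open>L\<^sup>2\<close>.\<close>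
  show ?thesis
    unfolding R_def[symmetric]
  proof (rule expectation_limit_bounded_L2[of S "real T" _ 1])
    fix n
    show "integrable (completion (P x)) (S n)" using S(1) Sm by (simp add: integrable_completion)
    show "expectation (S n) = 0" using S(2) Sm by (simp add: integral_completion)
    show "integrable (completion (P x)) (\<lambda>\<omega>. (S n \<omega>)\<^sup>2)" using S(3) Sm by (simp add: integrable_completion)
    have "real (T * Suc n) * \<delta> n = real T" by (simp add: \<delta>_def del: of_nat_Suc mult_Suc_right)
    then show "expectation (\<lambda>\<omega>. (S n \<omega>)\<^sup>2) \<le> real T" using S(4)[of n] Sm by (simp add: integral_completion)
  next
    show "AE \<omega> in completion (P x). (\<lambda>n. S n \<omega>) \<longlonglongrightarrow> W (R \<omega>) \<omega> - W 0 \<omega>"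
      by (rule AE_completion[OF lim])
    show "(\<lambda>\<omega>. W (R \<omega>) \<omega> - W 0 \<omega>) \<in> borel_measurable (completion (P x))" using Rm W0 by measurable
    have "AE \<omega> in P x. \<bar>W (R \<omega>) \<omega> - W 0 \<omega>\<bar> \<le> 1"
      using AE_start[OF x]
    proof eventually_elim
      case (elim \<omega>)
      then have "ennreal (R \<omega>) \<le> lifetime W \<omega>" using le[of \<omega>] by (auto simp: R(3) min_le_iff_disj)
      then have "W (R \<omega>) \<omega> \<in> {0..1}"
        using elim position_in_unit_interval[of W \<omega> "R \<omega>"] continuous_paths[of \<omega>] R by auto
      then show ?case using elim by auto
    qed
    then show "AE \<omega> in completion (P x). \<bar>W (R \<omega>) \<omega> - W 0 \<omega>\<bar> \<le> 1" by (rule AE_completion)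
  qed
qed

text \<open>Lets the horizon go to infinity. Up to the lifetime the path stays in
  \<open>[0, 1]\<close>, so the displacement is dominated by 1.\<close>

lemma optional_stopping:
  assumes \<rho>: "\<rho> \<in> stopping_times M F P"
    and le: "\<And>\<omega>. \<omega> \<in> space M \<Longrightarrow> \<rho> \<omega> \<le> lifetime W \<omega>"
    and x: "x \<in> {0<..<1}"
  shows "integrable (completion (P x)) (\<lambda>\<omega>. W (enn2real (\<rho> \<omega>)) \<omega>)"
    and "(LINT \<omega>|completion (P x). W (enn2real (\<rho> \<omega>)) \<omega>) = x"
proof -
  interpret P: prob_space "P x" by (rule prob_space_P)
  interpret prob_space "completion (P x)" by (rule P.prob_space_completion)
  have W0: "W 0 \<in> borel_measurable (completion (P x))" by (rule W_measurable_completion) simp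
  note m = position_measurable[OF \<rho>, of x]
  have AE: "AE \<omega> in completion (P x). \<omega> \<in> space M \<and> W 0 \<omega> = x \<and> W 0 \<omega> \<in> {0<..<1} \<and> lifetime W \<omega> < \<top>"
    using AE_completion[OF AE_start[OF x]] AE_completion[OF lifetime_finite[of x]]
    by eventually_elim auto
  have bound: "W t \<omega> \<in> {0..1}" if "\<omega> \<in> space M" "W 0 \<omega> \<in> {0<..<1}" "0 \<le> t" "ennreal t \<le> \<rho> \<omega>" for t \<omega>
  proof -
    have "ennreal t \<le> lifetime W \<omega>" using that le order_trans by blast
    then show ?thesis by (intro position_in_unit_interval continuous_paths that)
  qed
  have fin: "\<rho> \<omega> < \<top>" if "\<omega> \<in> space M" "lifetime W \<omega> < \<top>" for \<omega>
    using le[OF that(1)] that(2) by (rule le_less_trans)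
  show int: "integrable (completion (P x)) (\<lambda>\<omega>. W (enn2real (\<rho> \<omega>)) \<omega>)"
  proof (rule integrable_const_bound[where B=1, OF _ m])
    show "AE \<omega> in completion (P x). norm (W (enn2real (\<rho> \<omega>)) \<omega>) \<le> 1"
      using AE
    proof eventually_elim
      case (elim \<omega>)
      then show ?case using bound[of \<omega> "enn2real (\<rho> \<omega>)"] fin[of \<omega>] by auto
    qed
  qed
  have int0: "integrable (completion (P x)) (W 0)" and E0: "expectation (W 0) = x"
  proof -
    have eq: "AE \<omega> in completion (P x). W 0 \<omega> = x" using AE by eventually_elim auto
    show "integrable (completion (P x)) (W 0)"
      by (rule integrable_const_bound[where B="\<bar>x\<bar>", OF _ W0]) (use eq in auto)
    have "expectation (W 0) = expectation (\<lambda>_. x)" by (rule integral_cong_AE[OF W0 _ eq]) simp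
    then show "expectation (W 0) = x" by (simp add: prob_space[simplified])
  qed
  define Y where "Y T \<omega> = W (enn2real (min (\<rho> \<omega>) (ennreal (real T)))) \<omega> - W 0 \<omega>" for T \<omega>
  have "(\<lambda>T. expectation (Y T)) \<longlonglongrightarrow> expectation (\<lambda>\<omega>. W (enn2real (\<rho> \<omega>)) \<omega> - W 0 \<omega>)"
  proof (rule integral_dominated_convergence[where w="\<lambda>_. 1"])
    show "(\<lambda>\<omega>. W (enn2real (\<rho> \<omega>)) \<omega> - W 0 \<omega>) \<in> borel_measurable (completion (P x))" using m W0 by measurable
    have c: "(\<lambda>\<omega>. min (\<rho> \<omega>) (ennreal (real T))) \<in> stopping_times M F P" for T
      using stopping_times_min[OF \<rho>, of "\<lambda>_. ennreal (real T)"]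
      by (simp add: stopping_times_def stopping_time_const)
    show "Y T \<in> borel_measurable (completion (P x))" for T
      unfolding Y_def[abs_def] using position_measurable[OF c[of T], of x] W0 by measurable
    show "AE \<omega> in completion (P x). (\<lambda>T. Y T \<omega>) \<longlonglongrightarrow> W (enn2real (\<rho> \<omega>)) \<omega> - W 0 \<omega>"
      using AE
    proof eventually_elim
      case (elim \<omega>)
      then have "\<rho> \<omega> < \<top>" using fin by auto
      then obtain n :: nat where n: "\<rho> \<omega> \<le> ennreal (real n)"
        using real_arch_simple[of "enn2real (\<rho> \<omega>)"] by (metis ennreal_enn2real ennreal_leI)
      have "min (\<rho> \<omega>) (ennreal (real T)) = \<rho> \<omega>" if "n \<le> T" for T
        using n that by (auto intro!: min_absorb1 intro: order_trans ennreal_leI)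
      \<comment> \<open>On a path with finite lifetime the truncation at \<open>T\<close> has no
        effect once \<open>T\<close> passes \<open>\<rho> \<omega>\<close>, so convergence is
        trivial.\<close>
      then have "\<forall>\<^sub>F T in sequentially. Y T \<omega> = W (enn2real (\<rho> \<omega>)) \<omega> - W 0 \<omega>"
        unfolding eventually_sequentially Y_def by (intro exI[of _ n]) auto
      then show ?case by (rule tendsto_eventually)
    qed
    show "AE \<omega> in completion (P x). norm (Y T \<omega>) \<le> 1" for T
      using AE
    proof eventually_elim
      case (elim \<omega>)
      have "min (\<rho> \<omega>) (ennreal (real T)) < \<top>" by (simp add: min_less_iff_disj)
      then show ?case
        using bound[of \<omega> "enn2real (min (\<rho> \<omega>) (ennreal (real T)))"] elim by (auto simp: Y_def)
    qed
  qed simp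
  moreover have "expectation (Y T) = 0" for T
    unfolding Y_def[abs_def] by (rule optional_stopping_bounded[OF \<rho> le x])
  ultimately have "expectation (\<lambda>\<omega>. W (enn2real (\<rho> \<omega>)) \<omega> - W 0 \<omega>) = 0"
    using LIMSEQ_unique[OF _ tendsto_const] by simp
  then show "expectation (\<lambda>\<omega>. W (enn2real (\<rho> \<omega>)) \<omega>) = x"
    using int int0 E0 by simp
qed

section \<open>Verification\<close>

lemma ext_killed_measurable:
  assumes \<tau>: "\<tau> \<in> stopping_times M F P" and "reward \<phi>"
  shows "(\<lambda>\<omega>. ext \<phi> (killed W (\<tau> \<omega>) \<omega>)) \<in> borel_measurable (completion (P x))"
proof -
  \<comment> \<open>A reward is controlled on \<open>[0, 1]\<close> only, so it is cut off outside.
    Before the lifetime the path lies in \<open>(0, 1)\<close> and the cut-off changes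
    nothing.\<close>
  have \<phi>: "(\<lambda>y. indicator {0..1} y *\<^sub>R \<phi> y) \<in> borel_measurable borel"
    using assms(2) by (intro borel_measurable_continuous_on_indicator) (auto simp: reward_def)
  have [measurable]: "\<tau> \<in> borel_measurable (completion (P x))"
    by (rule stopping_times_measurable[OF \<tau>])
  have "lifetime W \<in> stopping_times M F P"
    by (rule exit_time_stopping) (rule lifetime_eq_exit_time)
  then have [measurable]: "lifetime W \<in> borel_measurable (completion (P x))"
    by (rule stopping_times_measurable)
  have [measurable]: "(\<lambda>\<omega>. indicator {0..1} (W (enn2real (\<tau> \<omega>)) \<omega>) *\<^sub>R \<phi> (W (enn2real (\<tau> \<omega>)) \<omega>))
      \<in> borel_measurable (completion (P x))"
    by (rule measurable_compose[OF position_measurable[OF \<tau>] \<phi>])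
  have eq: "ext \<phi> (killed W (\<tau> \<omega>) \<omega>) = (if \<tau> \<omega> < lifetime W \<omega>
      then indicator {0..1} (W (enn2real (\<tau> \<omega>)) \<omega>) *\<^sub>R \<phi> (W (enn2real (\<tau> \<omega>)) \<omega>) else 0)" for \<omega>
  proof (cases "\<tau> \<omega> < lifetime W \<omega>")
    case True
    then have "\<tau> \<omega> < \<top>" using top_greatest by (rule order.strict_trans2)
    then have "ennreal (enn2real (\<tau> \<omega>)) < exit_time 0 1 W \<omega>"
      using True by (simp add: lifetime_eq_exit_time)
    then have "W (enn2real (\<tau> \<omega>)) \<omega> \<in> {0<..<1}" by (intro before_exit_time) simp_all
    then show ?thesis using True by (simp add: killed_def ext_def)
  qed (simp add: killed_def ext_def)
  show ?thesis unfolding eq by measurable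
qed

lemma ext_killed_bounded:
  assumes "reward \<phi>"
  obtains c where "\<And>t \<omega>. \<bar>ext \<phi> (killed W t \<omega>)\<bar> \<le> c" "0 \<le> c"
proof -
  have "bounded (\<phi> ` {0..1})" using assms by (simp add: reward_def)
  then obtain c where c: "\<forall>y\<in>{0..1}. \<bar>\<phi> y\<bar> \<le> c" unfolding bounded_iff by fastforce
  have c0: "0 \<le> c" using bspec[OF c, of 0] by simp
  have "\<bar>ext \<phi> (killed W t \<omega>)\<bar> \<le> c" for t \<omega>
  proof (cases "t < lifetime W \<omega>")
    case True
    then have "t < \<top>" using top_greatest by (rule order.strict_trans2)
    then have "ennreal (enn2real t) < exit_time 0 1 W \<omega>" using True by (simp add: lifetime_eq_exit_time)
    then have "W (enn2real t) \<omega> \<in> {0<..<1}" by (intro before_exit_time) simp_all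
    then show ?thesis using True c by (simp add: killed_def ext_def)
  qed (simp add: killed_def ext_def c0)
  then show thesis using c0 by (rule that)
qed

lemma payoff_integrable:
  assumes \<tau>: "\<tau> \<in> stopping_times M F P" and \<sigma>: "\<sigma> \<in> stopping_times M F P"
    and "reward f" "reward g" "reward h"
  shows "integrable (completion (P x)) (\<lambda>\<omega>.
      ext f (killed W (\<tau> \<omega>) \<omega>) * indicator {\<omega>. \<tau> \<omega> < \<sigma> \<omega>} \<omega>
    + ext g (killed W (\<sigma> \<omega>) \<omega>) * indicator {\<omega>. \<sigma> \<omega> < \<tau> \<omega>} \<omega>
    + ext h (killed W (\<tau> \<omega>) \<omega>) * indicator {\<omega>. \<tau> \<omega> = \<sigma> \<omega>} \<omega>)"
proof -
  interpret P: prob_space "P x" by (rule prob_space_P)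
  interpret prob_space "completion (P x)" by (rule P.prob_space_completion)
  have [measurable]: "\<tau> \<in> borel_measurable (completion (P x))" "\<sigma> \<in> borel_measurable (completion (P x))"
    using \<tau> \<sigma> by (auto intro: stopping_times_measurable)
  have part: "integrable (completion (P x)) (\<lambda>\<omega>. ext \<phi> (killed W (\<rho> \<omega>) \<omega>) * indicator A \<omega>)"
    if r\<phi>: "reward \<phi>" and \<rho>: "\<rho> \<in> stopping_times M F P" and A: "{\<omega>\<in>space (completion (P x)). \<omega> \<in> A} \<in> sets (completion (P x))"
    for \<phi> \<rho> A
  proof -
    obtain c where c: "\<And>t \<omega>. \<bar>ext \<phi> (killed W t \<omega>)\<bar> \<le> c" "0 \<le> c"
      using ext_killed_bounded[OF r\<phi>] by metis
    have "(\<lambda>\<omega>. indicat_real A \<omega>) \<in> borel_measurable (completion (P x))"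
      using A by (subst borel_measurable_indicator_iff) (simp add: Int_def conj_commute)
    then show ?thesis
      using ext_killed_measurable[OF \<rho> r\<phi>, of x] c
      by (intro integrable_const_bound[where B=c]) (auto simp: indicator_def)
  qed
  have sets: "{\<omega>\<in>space (completion (P x)). \<omega> \<in> {\<omega>. \<tau> \<omega> < \<sigma> \<omega>}} \<in> sets (completion (P x))"
    "{\<omega>\<in>space (completion (P x)). \<omega> \<in> {\<omega>. \<sigma> \<omega> < \<tau> \<omega>}} \<in> sets (completion (P x))"
    "{\<omega>\<in>space (completion (P x)). \<omega> \<in> {\<omega>. \<tau> \<omega> = \<sigma> \<omega>}} \<in> sets (completion (P x))"
    unfolding mem_Collect_eq by measurable
  show ?thesis
    by (intro Bochner_Integration.integrable_add part sets assms)
qed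

text \<open>\<open>J\<close> is the payoff as a function of the position at which the game ends.
  Comparing it with an affine function there is enough, because optional stopping evaluates the mean
  of the affine function as its value at \<open>x\<close>.\<close>

lemma payoff_bound:
  assumes \<tau>: "\<tau> \<in> stopping_times M F P" and \<sigma>: "\<sigma> \<in> stopping_times M F P"
    and rew: "reward f" "reward g" "reward h" and x: "x \<in> {0<..<1}"
    and le: "\<And>\<omega>. \<omega> \<in> space M \<Longrightarrow> min (\<tau> \<omega>) (\<sigma> \<omega>) \<le> lifetime W \<omega>"
  defines "J \<equiv> \<lambda>\<omega> y. if \<tau> \<omega> < \<sigma> \<omega> then f y else if \<sigma> \<omega> < \<tau> \<omega> then g y else h y"
  shows payoff_le: "(\<And>\<omega> s. \<omega> \<in> space M \<Longrightarrow> W 0 \<omega> = x \<Longrightarrow> 0 \<le> s \<Longrightarrow> min (\<tau> \<omega>) (\<sigma> \<omega>) = ennreal s \<Longrightarrow>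
      W s \<omega> \<in> {0..1} \<Longrightarrow> J \<omega> (W s \<omega>) \<le> \<alpha> + \<beta> * W s \<omega>) \<Longrightarrow> payoff P W f g h x \<tau> \<sigma> \<le> \<alpha> + \<beta> * x"
    and payoff_ge: "(\<And>\<omega> s. \<omega> \<in> space M \<Longrightarrow> W 0 \<omega> = x \<Longrightarrow> 0 \<le> s \<Longrightarrow> min (\<tau> \<omega>) (\<sigma> \<omega>) = ennreal s \<Longrightarrow>
      W s \<omega> \<in> {0..1} \<Longrightarrow> \<alpha> + \<beta> * W s \<omega> \<le> J \<omega> (W s \<omega>)) \<Longrightarrow> \<alpha> + \<beta> * x \<le> payoff P W f g h x \<tau> \<sigma>"
proof -
  interpret P: prob_space "P x" by (rule prob_space_P)
  interpret prob_space "completion (P x)" by (rule P.prob_space_completion)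
  define I where "I \<omega> = ext f (killed W (\<tau> \<omega>) \<omega>) * indicator {\<omega>. \<tau> \<omega> < \<sigma> \<omega>} \<omega>
    + ext g (killed W (\<sigma> \<omega>) \<omega>) * indicator {\<omega>. \<sigma> \<omega> < \<tau> \<omega>} \<omega>
    + ext h (killed W (\<tau> \<omega>) \<omega>) * indicator {\<omega>. \<tau> \<omega> = \<sigma> \<omega>} \<omega>" for \<omega>
  define Y where "Y \<omega> = W (enn2real (min (\<tau> \<omega>) (\<sigma> \<omega>))) \<omega>" for \<omega>
  have pay: "payoff P W f g h x \<tau> \<sigma> = expectation I" unfolding payoff_def I_def[abs_def] ..
  have int: "integrable (completion (P x)) I"
    unfolding I_def[abs_def] by (rule payoff_integrable[OF \<tau> \<sigma> rew])
  note os = optional_stopping[OF stopping_times_min[OF \<tau> \<sigma>] le x, folded Y_def]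
  have intA: "integrable (completion (P x)) (\<lambda>\<omega>. \<alpha> + \<beta> * Y \<omega>)" using os(1) by simp
  have EA: "expectation (\<lambda>\<omega>. \<alpha> + \<beta> * Y \<omega>) = \<alpha> + \<beta> * x" using os prob_space by simp
  have AE: "AE \<omega> in completion (P x). \<exists>s. \<omega> \<in> space M \<and> W 0 \<omega> = x \<and> 0 \<le> s \<and> min (\<tau> \<omega>) (\<sigma> \<omega>) = ennreal s
      \<and> W s \<omega> \<in> {0..1} \<and> Y \<omega> = W s \<omega> \<and> I \<omega> = J \<omega> (W s \<omega>)"
    using AE_completion[OF AE_start[OF x]] AE_completion[OF lifetime_finite[of x]]
  proof eventually_elim
    case (elim \<omega>)
    define s where "s = enn2real (min (\<tau> \<omega>) (\<sigma> \<omega>))"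
    have \<omega>: "\<omega> \<in> space M" "W 0 \<omega> \<in> {0<..<1}" "W 0 \<omega> = x" using elim by auto
    have "min (\<tau> \<omega>) (\<sigma> \<omega>) < \<top>" using le[OF \<omega>(1)] elim(2) by (rule le_less_trans)
    then have s: "0 \<le> s" "min (\<tau> \<omega>) (\<sigma> \<omega>) = ennreal s" by (simp_all add: s_def)
    have sl: "ennreal s \<le> lifetime W \<omega>" using le[OF \<omega>(1)] s by simp
    have k: "ext \<phi> (killed W (ennreal s) \<omega>) = \<phi> (W s \<omega>)" if "reward \<phi>" for \<phi>
      using that by (intro ext_killed continuous_paths \<omega> s sl) (auto simp: reward_def)
    have "I \<omega> = J \<omega> (W s \<omega>)"
    proof (cases "\<tau> \<omega>" "\<sigma> \<omega>" rule: linorder_cases)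
      case less
      then have "\<tau> \<omega> = ennreal s" using s min_absorb1[OF less_imp_le[OF less]] by simp
      then show ?thesis using less k[OF rew(1)] by (simp add: I_def J_def)
    next
      case equal
      then have "\<tau> \<omega> = ennreal s" using s by simp
      then show ?thesis using equal k[OF rew(3)] by (simp add: I_def J_def)
    next
      case greater
      then have "\<sigma> \<omega> = ennreal s" using s min_absorb2[OF less_imp_le[OF greater]] by simp
      then show ?thesis using greater less_not_sym[OF greater] k[OF rew(2)] by (simp add: I_def J_def)
    qed
    moreover have "W s \<omega> \<in> {0..1}"
      by (intro position_in_unit_interval continuous_paths \<omega> s sl)
    ultimately show ?case using \<omega> s by (intro exI[of _ s]) (simp add: Y_def)
  qed
  {
    assume *: "\<And>\<omega> s. \<omega> \<in> space M \<Longrightarrow> W 0 \<omega> = x \<Longrightarrow> 0 \<le> s \<Longrightarrow> min (\<tau> \<omega>) (\<sigma> \<omega>) = ennreal s \<Longrightarrow>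
      W s \<omega> \<in> {0..1} \<Longrightarrow> J \<omega> (W s \<omega>) \<le> \<alpha> + \<beta> * W s \<omega>"
    have "expectation I \<le> expectation (\<lambda>\<omega>. \<alpha> + \<beta> * Y \<omega>)"
      by (rule integral_mono_AE[OF int intA]) (use AE in \<open>eventually_elim, use * in force\<close>)
    then show "payoff P W f g h x \<tau> \<sigma> \<le> \<alpha> + \<beta> * x" by (simp add: pay EA)
  }
  {
    assume *: "\<And>\<omega> s. \<omega> \<in> space M \<Longrightarrow> W 0 \<omega> = x \<Longrightarrow> 0 \<le> s \<Longrightarrow> min (\<tau> \<omega>) (\<sigma> \<omega>) = ennreal s \<Longrightarrow>
      W s \<omega> \<in> {0..1} \<Longrightarrow> \<alpha> + \<beta> * W s \<omega> \<le> J \<omega> (W s \<omega>)"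
    have "expectation (\<lambda>\<omega>. \<alpha> + \<beta> * Y \<omega>) \<le> expectation I"
      by (rule integral_mono_AE[OF intA int]) (use AE in \<open>eventually_elim, use * in force\<close>)
    then show "\<alpha> + \<beta> * x \<le> payoff P W f g h x \<tau> \<sigma>" by (simp add: pay EA)
  }
qed

text \<open>One lemma for both players: the opponent leaves \<open>(p, q)\<close>, the candidate
  reply leaves \<open>(p', q')\<close>. The affine function is a certificate: it bounds the payoff
  of every reply, and the candidate ends the game only where the bound is an equality.
  \<open>outside\<close> says that the two stopping regions are disjoint inside
  \<open>(0, 1)\<close>.\<close>

lemma exit_time_optimal:
  assumes rew: "reward f" "reward g" "reward h"
    and order: "\<And>y. y \<in> {0..1} \<Longrightarrow> f y \<le> h y \<and> h y \<le> g y"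
    and pq: "0 \<le> p" "q \<le> 1"
    and \<tau>\<^sub>0: "\<And>\<omega>. \<omega> \<in> space M \<Longrightarrow> \<tau>\<^sub>0 \<omega> = exit_time p' q' W \<omega>"
    and \<sigma>: "\<And>\<omega>. \<omega> \<in> space M \<Longrightarrow> \<sigma> \<omega> = exit_time p q W \<omega>"
    and x: "x \<in> {0<..<1}"
    and outside: "x \<notin> {p<..<q} \<Longrightarrow> x \<in> {p'<..<q'}"
    and inside: "x \<in> {p<..<q} \<Longrightarrow> \<exists>\<alpha> \<beta>. (\<forall>y\<in>{p<..<q}. f y \<le> \<alpha> + \<beta> * y) \<and> (\<forall>y\<in>{p, q}. g y \<le> \<alpha> + \<beta> * y) \<and>
      (x \<notin> {p'<..<q'} \<longrightarrow> f x = \<alpha> + \<beta> * x) \<and>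
      (x \<in> {p'<..<q'} \<longrightarrow> (\<forall>y\<in>{p', q'} \<inter> {p<..<q}. f y = \<alpha> + \<beta> * y) \<and>
        (\<forall>y\<in>{p, q} \<inter> {p'<..<q'}. g y = \<alpha> + \<beta> * y) \<and> (\<forall>y\<in>{p, q} \<inter> {p', q'}. h y = \<alpha> + \<beta> * y))"
  shows "payoff P W f g h x \<tau>\<^sub>0 \<sigma> = (SUP \<tau>\<in>stopping_times M F P. payoff P W f g h x \<tau> \<sigma>)"
proof -
  have \<tau>\<^sub>0_st: "\<tau>\<^sub>0 \<in> stopping_times M F P" by (rule exit_time_stopping[OF \<tau>\<^sub>0])
  have \<sigma>_st: "\<sigma> \<in> stopping_times M F P" by (rule exit_time_stopping[OF \<sigma>])
  have "\<sigma> \<omega> \<le> lifetime W \<omega>" if "\<omega> \<in> space M" for \<omega>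
    unfolding \<sigma>[OF that] lifetime_eq_exit_time using pq by (rule exit_time_mono)
  then have le: "min (\<tau> \<omega>) (\<sigma> \<omega>) \<le> lifetime W \<omega>" if "\<omega> \<in> space M" for \<omega> \<tau>
    using that by (simp add: min_le_iff_disj)
  note lb = payoff_ge[OF \<tau>\<^sub>0_st \<sigma>_st rew x le[where \<tau>=\<tau>\<^sub>0]]
  have "\<exists>v. (\<forall>\<tau>\<in>stopping_times M F P. payoff P W f g h x \<tau> \<sigma> \<le> v) \<and> v \<le> payoff P W f g h x \<tau>\<^sub>0 \<sigma>"
  proof (cases "x \<in> {p<..<q}")
    case False
    \<comment> \<open>The opponent stops at once and the candidate does not, so the candidate earns
      \<open>g x\<close>. This is the best possible: any other reply earns \<open>g x\<close> or, by
      stopping at once too, \<open>h x \<le> g x\<close>. The certificate is a constant, written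
      with slope 0.\<close>
    have \<sigma>0: "\<sigma> \<omega> = 0" if "\<omega> \<in> space M" "W 0 \<omega> = x" for \<omega>
      using that False \<sigma> exit_time_eq_0[of W \<omega> p q] by simp
    have \<tau>0: "0 < \<tau>\<^sub>0 \<omega>" if "\<omega> \<in> space M" "W 0 \<omega> = x" for \<omega>
      using that outside[OF False] \<tau>\<^sub>0 continuous_paths[of \<omega>] exit_time_pos[of W \<omega> p' q'] by simp
    have s0: "s = 0" if "0 \<le> s" "min t 0 = ennreal s" for s t
      using that by simp
    have "payoff P W f g h x \<tau> \<sigma> \<le> g x + 0 * x" if "\<tau> \<in> stopping_times M F P" for \<tau>
    proof (rule payoff_le[where \<tau>=\<tau>, OF that \<sigma>_st rew x le[where \<tau>=\<tau>]])
      fix \<omega> s assume \<omega>: "\<omega> \<in> space M" "W 0 \<omega> = x" "0 \<le> s" "min (\<tau> \<omega>) (\<sigma> \<omega>) = ennreal s"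
      then have "s = 0" using \<sigma>0 s0 by metis
      then show "(if \<tau> \<omega> < \<sigma> \<omega> then f (W s \<omega>) else if \<sigma> \<omega> < \<tau> \<omega> then g (W s \<omega>) else h (W s \<omega>)) \<le> g x + 0 * W s \<omega>"
        using \<omega> \<sigma>0 order[of x] x by auto
    qed
    moreover have "g x + 0 * x \<le> payoff P W f g h x \<tau>\<^sub>0 \<sigma>"
    proof (rule lb)
      fix \<omega> s assume \<omega>: "\<omega> \<in> space M" "W 0 \<omega> = x" "0 \<le> s" "min (\<tau>\<^sub>0 \<omega>) (\<sigma> \<omega>) = ennreal s"
      then have "s = 0" using \<sigma>0 s0 by metis
      then show "g x + 0 * W s \<omega> \<le> (if \<tau>\<^sub>0 \<omega> < \<sigma> \<omega> then f (W s \<omega>) else if \<sigma> \<omega> < \<tau>\<^sub>0 \<omega> then g (W s \<omega>) else h (W s \<omega>))"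
        using \<omega> \<sigma>0 \<tau>0 by auto
    qed
    ultimately show ?thesis by blast
  next
    case True
    obtain \<alpha> \<beta> where A: "\<And>y. y \<in> {p<..<q} \<Longrightarrow> f y \<le> \<alpha> + \<beta> * y" "\<And>y. y \<in> {p, q} \<Longrightarrow> g y \<le> \<alpha> + \<beta> * y"
      "x \<notin> {p'<..<q'} \<Longrightarrow> f x = \<alpha> + \<beta> * x"
      "\<And>y. x \<in> {p'<..<q'} \<Longrightarrow> y \<in> {p', q'} \<inter> {p<..<q} \<Longrightarrow> f y = \<alpha> + \<beta> * y"
      "\<And>y. x \<in> {p'<..<q'} \<Longrightarrow> y \<in> {p, q} \<inter> {p'<..<q'} \<Longrightarrow> g y = \<alpha> + \<beta> * y"
      "\<And>y. x \<in> {p'<..<q'} \<Longrightarrow> y \<in> {p, q} \<inter> {p', q'} \<Longrightarrow> h y = \<alpha> + \<beta> * y"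
      using inside[OF True] by (elim exE) (rule that; blast)
    have \<sigma>_at: "W s \<omega> \<in> {p, q}" if "\<omega> \<in> space M" "W 0 \<omega> = x" "0 \<le> s" "\<sigma> \<omega> = ennreal s" for \<omega> s
      using continuous_paths[of \<omega>] exit_time_boundary[of W \<omega> p q s] that True \<sigma> by simp
    have \<sigma>_before: "W s \<omega> \<in> {p<..<q}" if "\<omega> \<in> space M" "0 \<le> s" "ennreal s < \<sigma> \<omega>" for \<omega> s
      using before_exit_time[of s p q W \<omega>] that \<sigma> by simp
    have "payoff P W f g h x \<tau> \<sigma> \<le> \<alpha> + \<beta> * x" if "\<tau> \<in> stopping_times M F P" for \<tau>
    proof (rule payoff_le[where \<tau>=\<tau>, OF that \<sigma>_st rew x le[where \<tau>=\<tau>]])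
      fix \<omega> s assume \<omega>: "\<omega> \<in> space M" "W 0 \<omega> = x" "0 \<le> s" "min (\<tau> \<omega>) (\<sigma> \<omega>) = ennreal s" "W s \<omega> \<in> {0..1}"
      show "(if \<tau> \<omega> < \<sigma> \<omega> then f (W s \<omega>) else if \<sigma> \<omega> < \<tau> \<omega> then g (W s \<omega>) else h (W s \<omega>)) \<le> \<alpha> + \<beta> * W s \<omega>"
      proof (cases "\<tau> \<omega> < \<sigma> \<omega>")
        case True
        then show ?thesis using A(1)[OF \<sigma>_before[OF \<omega>(1,3)]] \<omega>(4) min_absorb1[OF less_imp_le[OF True]] by simp
      next
        case False
        then have "\<sigma> \<omega> = ennreal s" using \<omega>(4) by (simp add: min_def split: if_splits)
        \<comment> \<open>When the opponent stops first the payoff is \<open>g\<close>, on a tie it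
          is \<open>h \<le> g\<close>; a bound on \<open>g\<close> covers both.\<close>
        then have "g (W s \<omega>) \<le> \<alpha> + \<beta> * W s \<omega>" using A(2) \<sigma>_at \<omega> by blast
        then show ?thesis using False order[OF \<omega>(5)] by auto
      qed
    qed
    moreover have "\<alpha> + \<beta> * x \<le> payoff P W f g h x \<tau>\<^sub>0 \<sigma>"
    proof (rule lb)
      fix \<omega> s assume \<omega>: "\<omega> \<in> space M" "W 0 \<omega> = x" "0 \<le> s" "min (\<tau>\<^sub>0 \<omega>) (\<sigma> \<omega>) = ennreal s"
      show "\<alpha> + \<beta> * W s \<omega> \<le> (if \<tau>\<^sub>0 \<omega> < \<sigma> \<omega> then f (W s \<omega>) else if \<sigma> \<omega> < \<tau>\<^sub>0 \<omega> then g (W s \<omega>) else h (W s \<omega>))"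
      proof (cases "x \<in> {p'<..<q'}")
        case False
        then have "\<tau>\<^sub>0 \<omega> = 0" using \<omega> \<tau>\<^sub>0 exit_time_eq_0[of W \<omega> p' q'] by simp
        moreover have "0 < \<sigma> \<omega>" using \<omega> True \<sigma> continuous_paths[of \<omega>] exit_time_pos[of W \<omega> p q] by simp
        ultimately show ?thesis using \<omega> A(3)[OF False] by simp
      next
        case in': True
        have \<tau>_at: "W s \<omega> \<in> {p', q'}" if "\<tau>\<^sub>0 \<omega> = ennreal s"
          using continuous_paths[of \<omega>] exit_time_boundary[of W \<omega> p' q' s] that in' \<tau>\<^sub>0 \<omega> by simp
        have \<tau>_before: "W s \<omega> \<in> {p'<..<q'}" if "ennreal s < \<tau>\<^sub>0 \<omega>"
          using before_exit_time[of s p' q' W \<omega>] that \<tau>\<^sub>0 \<omega> by simp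
        show ?thesis
        proof (cases "\<tau>\<^sub>0 \<omega>" "\<sigma> \<omega>" rule: linorder_cases)
          case less
          then have "\<tau>\<^sub>0 \<omega> = ennreal s" using \<omega>(4) min_absorb1[OF less_imp_le[OF less]] by simp
          then have "W s \<omega> \<in> {p', q'} \<inter> {p<..<q}" using \<tau>_at \<sigma>_before[OF \<omega>(1,3)] less by auto
          then show ?thesis using A(4)[OF in'] less by auto
        next
          case equal
          \<comment> \<open>A tie can occur only at a common end point of the two intervals. For
            thresholds \<open>l < r\<close> this is 0 or 1, where all rewards vanish.\<close>
          then have "\<tau>\<^sub>0 \<omega> = ennreal s" "\<sigma> \<omega> = ennreal s" using \<omega>(4) by simp_all
          then have "W s \<omega> \<in> {p, q} \<inter> {p', q'}" using \<tau>_at \<sigma>_at[OF \<omega>(1,2,3)] by blast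
          then show ?thesis using A(6)[OF in'] equal by auto
        next
          case greater
          then have "\<sigma> \<omega> = ennreal s" using \<omega>(4) min_absorb2[OF less_imp_le[OF greater]] by simp
          then have "W s \<omega> \<in> {p, q} \<inter> {p'<..<q'}" using \<tau>_before \<sigma>_at[OF \<omega>(1,2,3)] greater by auto
          then show ?thesis using A(5)[OF in'] greater less_not_sym[OF greater] by auto
        qed
      qed
    qed
    ultimately show ?thesis by blast
  qed
  then obtain v where v: "\<And>\<tau>. \<tau> \<in> stopping_times M F P \<Longrightarrow> payoff P W f g h x \<tau> \<sigma> \<le> v"
    "v \<le> payoff P W f g h x \<tau>\<^sub>0 \<sigma>" by blast
  show ?thesis
    by (rule cSup_eq_maximum[symmetric]) (use v \<tau>\<^sub>0_st in \<open>auto intro: order_trans\<close>)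
qed

end

theorem theorem4p4:
  fixes M :: "'w measure" and F :: "ennreal \<Rightarrow> 'w measure"
    and P :: "real \<Rightarrow> 'w measure" and W :: "real \<Rightarrow> 'w \<Rightarrow> real"
    and f g h :: "nat \<Rightarrow> real \<Rightarrow> real" and a b :: real
  assumes "brownian_family M F P W"
    and "\<forall>i\<in>{1, 2}. reward (f i) \<and> reward (g i) \<and> reward (h i)"
    and "\<forall>i\<in>{1, 2}. \<forall>x\<in>{0..1}. f i x \<le> h i x \<and> h i x \<le> g i x"
    and "a \<in> {0<..<1}" and "b \<in> {0<..<1}"
    and "concave_on {0..a} (f 1)" and "convex_on {a..1} (f 1)"
    and "convex_on {0..b} (f 2)" and "concave_on {b..1} (f 2)"
    and "b \<le> a \<longrightarrow> (\<forall>i\<in>{1, 2}. \<forall>x\<in>{b..a}. f i x < g i x)"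
  shows "\<exists>l\<in>{0..a}. \<exists>r\<in>{b..1}.
    dynkin_solution M F P W f g h (entry_time W {0..l}) (entry_time W {r..1})"
proof -
  interpret brownian_family M F P W by fact
  have rew: "reward (f 1)" "reward (g 1)" "reward (h 1)" "reward (f 2)" "reward (g 2)" "reward (h 2)"
    using assms(2) by auto
  have order1: "\<And>x. x \<in> {0..1} \<Longrightarrow> f 1 x \<le> h 1 x \<and> h 1 x \<le> g 1 x"
    and order2: "\<And>x. x \<in> {0..1} \<Longrightarrow> f 2 x \<le> h 2 x \<and> h 2 x \<le> g 2 x"
    using assms(3) by auto
  have ab: "0 < a" "a < 1" "0 < b" "b < 1" using assms(4,5) by auto
  have less: "f 1 x < g 1 x \<and> f 2 x < g 2 x" if "x \<in> {b..a}" for x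
    using assms(10) that by auto
  have ends: "f 1 0 = 0" "g 1 0 = 0" "g 1 1 = 0" "h 1 0 = 0" "h 1 1 = 0"
    "f 2 1 = 0" "g 2 0 = 0" "g 2 1 = 0" "h 2 0 = 0" "h 2 1 = 0"
    using rew by (auto simp: reward_def)
  obtain l r where lr: "l \<in> {0..a}" "r \<in> {b..1}" and best1: "best_reply (f 1) a r (g 1 r) l"
    and best2: "best_reply (\<lambda>y. f 2 (1 - y)) (1 - b) (1 - l) (g 2 l) (1 - r)"
    by (rule mutual_best_reply[OF assms(4,5), of "f 1" "f 2" "g 1" "g 2"])
      (use rew assms(6,9) less in \<open>auto simp: reward_def\<close>)
  \<comment> \<open>The limit yields only the closed condition, so the strict order of the
    thresholds is derived afresh from condition (iii).\<close>
  have "l < r" by (rule best_reply_less[OF best1 lr(1)]) (use less ab lr in auto)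
  then have lr': "0 \<le> l" "l \<le> a" "l < r" "r \<le> 1" "b \<le> r" "l < 1" "0 < r" using lr ab by auto
  have \<tau>\<^sub>1: "entry_time W {0..l} \<omega> = exit_time l 1 W \<omega>" if "\<omega> \<in> space M" for \<omega>
    by (rule entry_time_eq_exit_time[where W=W]) (use continuous_paths[OF that] lr' in auto)
  have \<tau>\<^sub>2: "entry_time W {r..1} \<omega> = exit_time 0 r W \<omega>" if "\<omega> \<in> space M" for \<omega>
    by (rule entry_time_eq_exit_time[where W=W]) (use continuous_paths[OF that] lr' in auto)
  have "payoff P W (f 1) (g 1) (h 1) x (entry_time W {0..l}) (entry_time W {r..1})
      = (SUP \<tau>\<in>stopping_times M F P. payoff P W (f 1) (g 1) (h 1) x \<tau> (entry_time W {r..1}))"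
    if x: "x \<in> {0<..<1}" for x
  proof (rule exit_time_optimal[OF rew(1-3) order1 _ _ \<tau>\<^sub>1 \<tau>\<^sub>2 x])
    assume "x \<in> {0<..<r}"
    moreover have "f 1 r \<le> g 1 r" using order1[of r] lr' by auto
    ultimately obtain \<alpha> \<beta> where A: "\<And>y. y \<in> {0..r} \<Longrightarrow> f 1 y \<le> \<alpha> + \<beta> * y" "g 1 r \<le> \<alpha> + \<beta> * r"
      "x \<le> l \<Longrightarrow> \<alpha> + \<beta> * x = f 1 x" "l < x \<Longrightarrow> \<alpha> + \<beta> * l = f 1 l \<and> \<alpha> + \<beta> * r = g 1 r"
      using affine_majorant[OF assms(6,7) ab(1) lr'(1-4) _ best1, of x] by auto
    \<comment> \<open>Player 2's exit from \<open>(0, r)\<close> may also take place at 0, where the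
      payoff is 0; the majorant must be nonnegative there.\<close>
    have "0 \<le> \<alpha>" using A(1)[of 0] lr' ends by simp
    then show "\<exists>\<alpha> \<beta>. (\<forall>y\<in>{0<..<r}. f 1 y \<le> \<alpha> + \<beta> * y) \<and> (\<forall>y\<in>{0, r}. g 1 y \<le> \<alpha> + \<beta> * y) \<and>
      (x \<notin> {l<..<1} \<longrightarrow> f 1 x = \<alpha> + \<beta> * x) \<and>
      (x \<in> {l<..<1} \<longrightarrow> (\<forall>y\<in>{l, 1} \<inter> {0<..<r}. f 1 y = \<alpha> + \<beta> * y) \<and>
        (\<forall>y\<in>{0, r} \<inter> {l<..<1}. g 1 y = \<alpha> + \<beta> * y) \<and> (\<forall>y\<in>{0, r} \<inter> {l, 1}. h 1 y = \<alpha> + \<beta> * y))"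
      using A lr' ends x by (intro exI[of _ \<alpha>] exI[of _ \<beta>]) auto
  qed (use lr' x in auto)
  moreover have "payoff P W (f 2) (g 2) (h 2) x (entry_time W {r..1}) (entry_time W {0..l})
      = (SUP \<tau>\<in>stopping_times M F P. payoff P W (f 2) (g 2) (h 2) x \<tau> (entry_time W {0..l}))"
    if x: "x \<in> {0<..<1}" for x
  proof (rule exit_time_optimal[OF rew(4-6) order2 _ _ \<tau>\<^sub>2 \<tau>\<^sub>1 x])
    assume xl: "x \<in> {l<..<1}"
    have "f 2 l \<le> g 2 l" using order2[of l] lr' ab by auto
    then obtain \<alpha> \<beta> where A: "\<And>y. y \<in> {0..1 - l} \<Longrightarrow> f 2 (1 - y) \<le> \<alpha> + \<beta> * y"
      "g 2 l \<le> \<alpha> + \<beta> * (1 - l)" "1 - x \<le> 1 - r \<Longrightarrow> \<alpha> + \<beta> * (1 - x) = f 2 x"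
      "1 - r < 1 - x \<Longrightarrow> \<alpha> + \<beta> * (1 - r) = f 2 r \<and> \<alpha> + \<beta> * (1 - l) = g 2 l"
      using affine_majorant[OF concave_on_reflect[OF assms(9)] convex_on_reflect[OF assms(8)] _ _ _ _ _ _ best2, of "1 - x"]
        xl lr' ab by auto
    \<comment> \<open>Back in the original coordinate, \<open>\<alpha> + \<beta> * (1 - y)\<close>
      has intercept \<open>\<alpha> + \<beta>\<close> and slope \<open>- \<beta>\<close>. The number
      \<open>\<alpha>\<close> is its value at 1, the other point where player 1's exit from
      \<open>(l, 1)\<close> can occur.\<close>
    have A1: "f 2 y \<le> (\<alpha> + \<beta>) + - \<beta> * y" if "y \<in> {l..1}" for y
      using A(1)[of "1 - y"] that by (simp add: algebra_simps)
    have "0 \<le> \<alpha>" using A(1)[of 0] lr' ends by simp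
    then show "\<exists>\<alpha> \<beta>. (\<forall>y\<in>{l<..<1}. f 2 y \<le> \<alpha> + \<beta> * y) \<and> (\<forall>y\<in>{l, 1}. g 2 y \<le> \<alpha> + \<beta> * y) \<and>
      (x \<notin> {0<..<r} \<longrightarrow> f 2 x = \<alpha> + \<beta> * x) \<and>
      (x \<in> {0<..<r} \<longrightarrow> (\<forall>y\<in>{0, r} \<inter> {l<..<1}. f 2 y = \<alpha> + \<beta> * y) \<and>
        (\<forall>y\<in>{l, 1} \<inter> {0<..<r}. g 2 y = \<alpha> + \<beta> * y) \<and> (\<forall>y\<in>{l, 1} \<inter> {0, r}. h 2 y = \<alpha> + \<beta> * y))"
      using A(2-4) A1 lr' ends x by (intro exI[of _ "\<alpha> + \<beta>"] exI[of _ "- \<beta>"]) (auto simp: algebra_simps)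
  qed (use lr' x in auto)
  moreover have "entry_time W {0..l} \<in> stopping_times M F P" "entry_time W {r..1} \<in> stopping_times M F P"
    using exit_time_stopping[OF \<tau>\<^sub>1] exit_time_stopping[OF \<tau>\<^sub>2] by auto
  ultimately show ?thesis
    using lr unfolding dynkin_solution_def by (intro bexI[of _ l] bexI[of _ r]) auto
qed

end
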